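(* Let $F_0,F_1$ be distinct probability distributions with common support and positive densities $f_0,f_1$ on it, let $h(x)=f_1(x)/f_0(x)$, and let $X_1,X_2,\ldots$ be independent with distribution $F_0$. For each $n$ let $\hat\theta_n$ be the maximum-likelihood estimator of $\theta\in[0,1]$ based on $X_1,\ldots,X_n$ in the mixture model with density $(1-\theta)f_0+\theta f_1$. Suppose that the distribution of $h(X_1)$ belongs to the domain of attraction of a stable law with index $\alpha$, where $1<\alpha\le 2$. Then $$\lim_{n\to\infty}\mathbb{P}_0(\hat\theta_n>0)=1-\frac1\alpha .$$
   Context: $\mathbb{P}_0$ denotes probability when $X_1,\ldots,X_n$ are i.i.d. from $F_0$. The maximum-likelihood estimator $\hat\theta_n$ maximizes $\sum_{i=1}^n\log\{(1-\theta)f_0(X_i)+\theta f_1(X_i)\}$, a concave function of $\theta$, over $\theta\in[0,1]$. A distribution belongs to the domain of attraction of a stable law with index $\alpha$ if, for i.i.d. variables $Y_1,Y_2,\ldots$ with that distribution, there exist deterministic sequences $A_n\in\mathbb{R}$, $B_n>0$ such that $B_n^{-1}\sum_{i=1}^nY_i-A_n$ converges in distribution to a non-degenerate stable law of index $\alpha$ (Gaussian when $\alpha=2$). *)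

theory Defs
  imports "HOL-Probability.Probability"
begin

text \<open>Samorodnitsky and Taqqu: if \<open>Z, Z'\<close> are independent copies, then
  \<open>a * Z + b * Z'\<close> has the law of \<open>c * Z + d\<close>, where \<open>c\<close> is tied to \<open>a, b\<close> by the index.
  For \<open>\<alpha> = 2\<close> these are exactly the non-degenerate Gaussian laws.\<close>

definition stable_law :: "real \<Rightarrow> real measure \<Rightarrow> bool" where
  "stable_law \<alpha> \<mu> \<longleftrightarrow>
     0 < \<alpha> \<and> \<alpha> \<le> 2 \<and> real_distribution \<mu> \<and> (\<nexists>c. \<mu> = return borel c) \<and>
     (\<forall>a>0. \<forall>b>0. \<exists>c>0. \<exists>d. c powr \<alpha> = a powr \<alpha> + b powr \<alpha> \<and>
        distr \<mu> borel (\<lambda>z. a * z) \<star> distr \<mu> borel (\<lambda>z. b * z) = distr \<mu> borel (\<lambda>z. c * z + d))"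

text \<open>The i.i.d. sequence with law \<open>\<nu>\<close> is realised by the coordinates of the product space.\<close>

definition domain_of_attraction :: "real \<Rightarrow> real measure \<Rightarrow> bool" where
  "domain_of_attraction \<alpha> \<nu> \<longleftrightarrow> real_distribution \<nu> \<and>
     (\<exists>A B \<mu>. (\<forall>n. 0 < B n) \<and> stable_law \<alpha> \<mu> \<and>
        weak_conv_m
          (\<lambda>n. distr (PiM UNIV (\<lambda>_::nat. \<nu>)) borel (\<lambda>y. (\<Sum>i<n. y i) / B n - A n)) \<mu>)"

definition log_likelihood ::
    "('a \<Rightarrow> real) \<Rightarrow> ('a \<Rightarrow> real) \<Rightarrow> nat \<Rightarrow> (nat \<Rightarrow> 'a) \<Rightarrow> real \<Rightarrow> real" where
  "log_likelihood f\<^sub>0 f\<^sub>1 n x \<theta> = (\<Sum>i<n. ln ((1 - \<theta>) * f\<^sub>0 (x i) + \<theta> * f\<^sub>1 (x i)))"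

text \<open>A relation, not a function: if \<open>f\<^sub>0 (x i) = f\<^sub>1 (x i)\<close> for all \<open>i < n\<close>, every point of
  the unit interval is a maximizer.\<close>

definition is_mle ::
    "('a \<Rightarrow> real) \<Rightarrow> ('a \<Rightarrow> real) \<Rightarrow> nat \<Rightarrow> (nat \<Rightarrow> 'a) \<Rightarrow> real \<Rightarrow> bool" where
  "is_mle f\<^sub>0 f\<^sub>1 n x \<theta> \<longleftrightarrow> is_arg_max (log_likelihood f\<^sub>0 f\<^sub>1 n x) (\<lambda>t. t \<in> {0..1}) \<theta>"

end

theory Submission
  imports Defs "HOL-Complex_Analysis.Conformal_Mappings" "HOL-Real_Asymp.Real_Asymp"
begin

text \<open>
  Let \<open>Y\<^sub>i = h (X\<^sub>i)\<close>. Under \<open>F\<^sub>0\<close> these variables are i.i.d. and nonnegative, have mean 1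
  because \<open>F\<^sub>1\<close> has total mass 1, and are not constant because \<open>F\<^sub>0 \<noteq> F\<^sub>1\<close>. The log-likelihood
  is concave in \<open>\<theta>\<close> with slope \<open>\<Sum>i<n. (Y\<^sub>i - 1)\<close> at 0, so up to ties the estimator is positive
  exactly when \<open>Z\<^sub>n = (\<Sum>i<n. (Y\<^sub>i - 1)) / B\<^sub>n\<close> is (\<open>mle_sign\<close>). What is needed is the mass that
  the limits of \<open>Z\<^sub>n\<close> give to the positive half-line. The hypothesis supplies a stable limit
  only for some centring of the sums, and only through its stability equation; its skewness is
  recovered from the one-sidedness \<open>Y\<^sub>i \<ge> 0\<close>, which makes the transform \<open>E exp (- s Z\<^sub>n)\<close> finite
  for all \<open>s \<ge> 0\<close>.

  Control of that transform. Tightness of the normed sums bounds \<open>n E min ((Y/B\<^sub>n)\<^sup>2) 1\<close>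
  (\<open>truncated_second_moment_bound\<close>), and stability forces \<open>B\<^bsub>2n\<^esub> \<le> \<rho> B\<^sub>n\<close> eventually, for some
  \<open>\<rho> < 2\<close> (\<open>norming_growth\<close>); here \<open>\<alpha> > 1\<close> enters. Adding these bounds over dyadic scales also
  controls the first moment in the tail (\<open>truncated_moment_bound\<close>), with a gain of \<open>2 ^ - k\<close>
  when \<open>B\<^sub>n\<close> is replaced by \<open>\<rho> ^ k B\<^sub>n\<close>. Since \<open>E Y = 1\<close>, it follows that
  \<open>1 \<le> E exp (- s Z\<^sub>n) \<le> exp (\<psi>\<^sub>n s)\<close> with \<open>\<psi>\<^sub>n s\<close> bounded for large \<open>n\<close> and, uniformly in such
  \<open>n\<close>, \<open>o(s)\<close> along \<open>s = \<rho> ^ - k\<close>. So the centring at the mean differs from the given one by a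
  bounded amount, and along subsequences \<open>Z\<^sub>n\<close> converges to a translate \<open>L\<close> of the stable law
  with \<open>E exp (- s L) = exp (\<psi> s)\<close>, \<open>\<psi> \<ge> 0\<close>.

  Identification of the limit. Because \<open>\<psi> s = o(s)\<close> along these scales, no drift survives in the
  stability equation, which becomes Cauchy's functional equation in \<open>s powr \<alpha>\<close>; hence
  \<open>\<psi> s = \<gamma> * s powr \<alpha>\<close> with \<open>\<gamma> > 0\<close> (\<open>stable_exponent_is_power\<close>). By the identity theorem the
  characteristic function of \<open>L\<close> is \<open>exp (\<gamma> (\<i> t) powr \<alpha>)\<close> at \<open>- t\<close> for \<open>t > 0\<close>
  (\<open>char_of_laplace_powr\<close>).

  Evaluation. Dirichlet's integral turns \<open>E sgn L\<close> into
  \<open>- 2/\<pi> * (\<integral> Im (exp (\<gamma> * t powr \<alpha> * cis \<theta>)) / t)\<close> over \<open>t > 0\<close> with \<open>\<theta> = \<pi>\<alpha>/2\<close>, and rotating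
  the ray from \<open>\<theta>\<close> to \<open>\<pi>\<close> evaluates the integral as \<open>(\<pi> - \<theta>)/\<alpha>\<close>. So \<open>E sgn L = 1 - 2/\<alpha>\<close>; as \<open>L\<close>
  has no atom at 0, \<open>P (L > 0) = 1 - 1/\<alpha>\<close> (\<open>positivity_of_laplace_powr\<close>). The value does not
  depend on the subsequence, so the whole sequence converges.
\<close>

section \<open>Characteristic functions and weak convergence\<close>

lemma norm_iexp_diff_le: "norm (iexp x - iexp y) \<le> min 2 \<bar>x - y\<bar>"
proof -
  have eq: "iexp x - iexp y = iexp y * (iexp (x - y) - 1)"
    by (simp add: algebra_simps flip: exp_add)
  have "norm (iexp x - iexp y) = norm (iexp (x - y) - 1)"
    unfolding eq norm_mult by simp
  also have "\<dots> \<le> \<bar>x - y\<bar>" using iexp_approx1[of "x - y" 0] by simp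
  finally have "norm (iexp x - iexp y) \<le> \<bar>x - y\<bar>" .
  moreover have "norm (iexp x - iexp y) \<le> 2"
    using norm_triangle_ineq4[of "iexp x" "iexp y"] by simp
  ultimately show ?thesis by simp
qed

lemma (in real_distribution) norm_char_diff_le:
  assumes "\<bar>s - t\<bar> \<le> r"
  shows "norm (char M s - char M t) \<le> (LINT x|M. min 2 (r * \<bar>x\<bar>))"
proof -
  have r: "r \<ge> 0" using assms by linarith
  have "norm (char M s - char M t) = norm (CLINT x|M. iexp (s * x) - iexp (t * x))"
    unfolding char_def by (subst Bochner_Integration.integral_diff) (auto intro!: integrable_iexp)
  also have "\<dots> \<le> (LINT x|M. norm (iexp (s * x) - iexp (t * x)))"
    by (rule integral_norm_bound)
  also have "\<dots> \<le> (LINT x|M. min 2 (r * \<bar>x\<bar>))"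
  proof (rule integral_mono)
    show "integrable M (\<lambda>x. norm (iexp (s * x) - iexp (t * x)))"
      by (intro integrable_norm Bochner_Integration.integrable_diff) (auto intro!: integrable_iexp)
    show "integrable M (\<lambda>x. min 2 (r * \<bar>x\<bar>))"
      using r by (intro integrable_const_bound[where B = 2]) auto
    show "norm (iexp (s * x) - iexp (t * x)) \<le> min 2 (r * \<bar>x\<bar>)" for x
    proof -
      have "\<bar>s * x - t * x\<bar> \<le> r * \<bar>x\<bar>"
        using assms by (simp add: mult_right_mono flip: left_diff_distrib abs_mult) (simp add: abs_mult mult_right_mono)
      then show ?thesis using norm_iexp_diff_le[of "s * x" "t * x"] by simp
    qed
  qed
  finally show ?thesis .
qed

lemma (in real_distribution) char_uminus: "char M (- t) = cnj (char M t)"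
  unfolding char_def by (subst Bochner_Integration.integral_cnj[symmetric]) (simp add: exp_cnj)

text \<open>
  Tightness in integrated form: it avoids tail sets and bounds at once the modulus of continuity
  of every characteristic function in the sequence.
\<close>

lemma weak_conv_tight:
  assumes Mn: "\<And>n. real_distribution (Mn n)" and M: "real_distribution M"
    and weak: "weak_conv_m Mn M" and e: "\<epsilon> > 0"
  shows "\<exists>r>0. \<forall>\<^sub>F n in sequentially. (LINT x|Mn n. min 2 (r * \<bar>x\<bar>)) < \<epsilon>"
proof -
  interpret M: real_distribution M by fact
  have "(\<lambda>k. LINT x|M. min 2 (1 / real (Suc k) * \<bar>x\<bar>)) \<longlonglongrightarrow> (LINT x|M. 0)"
  proof (rule integral_dominated_convergence[where w = "\<lambda>_. 2"])
    have "(\<lambda>k. min 2 (1 / real (Suc k) * \<bar>x\<bar>)) \<longlonglongrightarrow> min 2 (0 * \<bar>x\<bar>)" for x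
      by (intro tendsto_intros LIMSEQ_Suc[OF lim_1_over_n])
    then show "AE x in M. (\<lambda>k. min 2 (1 / real (Suc k) * \<bar>x\<bar>)) \<longlonglongrightarrow> 0" by simp
  qed auto
  then have "\<forall>\<^sub>F k in sequentially. (LINT x|M. min 2 (1 / real (Suc k) * \<bar>x\<bar>)) < \<epsilon>"
    using e by (intro order_tendstoD) auto
  then obtain k where k: "(LINT x|M. min 2 (1 / real (Suc k) * \<bar>x\<bar>)) < \<epsilon>"
    by (auto simp: eventually_sequentially)
  define r where "r = 1 / real (Suc k)"
  have r: "r > 0" by (simp add: r_def)
  have "(\<lambda>n. LINT x|Mn n. min 2 (r * \<bar>x\<bar>)) \<longlonglongrightarrow> (LINT x|M. min 2 (r * \<bar>x\<bar>))"
    using r by (intro weak_conv_imp_integral_bdd_continuous_conv[OF Mn M weak, where B = 2]) (auto intro!: continuous_intros)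
  then have "\<forall>\<^sub>F n in sequentially. (LINT x|Mn n. min 2 (r * \<bar>x\<bar>)) < \<epsilon>"
    using k by (intro order_tendstoD) (auto simp: r_def)
  then show ?thesis using r by blast
qed

lemma weak_conv_char_equicontinuous:
  assumes Mn: "\<And>n. real_distribution (Mn n)" and M: "real_distribution M"
    and weak: "weak_conv_m Mn M" and e: "\<epsilon> > 0"
  shows "\<exists>r>0. \<forall>\<^sub>F n in sequentially. \<forall>s t. \<bar>s - t\<bar> \<le> r \<longrightarrow> norm (char (Mn n) s - char (Mn n) t) \<le> \<epsilon>"
proof -
  obtain r where r: "r > 0" "\<forall>\<^sub>F n in sequentially. (LINT x|Mn n. min 2 (r * \<bar>x\<bar>)) < \<epsilon>"
    using weak_conv_tight[OF assms] by blast
  from r(2) have "\<forall>\<^sub>F n in sequentially. \<forall>s t. \<bar>s - t\<bar> \<le> r \<longrightarrow> norm (char (Mn n) s - char (Mn n) t) \<le> \<epsilon>"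
  proof eventually_elim
    case (elim n)
    interpret real_distribution "Mn n" by (rule Mn)
    show ?case using norm_char_diff_le elim by (meson less_imp_le order_trans)
  qed
  then show ?thesis using r by blast
qed

text \<open>
  Equicontinuity upgrades pointwise convergence of characteristic functions to convergence along
  moving arguments, as needed when two norming constants are compared.
\<close>

lemma weak_conv_char_continuous:
  assumes Mn: "\<And>n. real_distribution (Mn n)" and M: "real_distribution M"
    and weak: "weak_conv_m Mn M" and t: "tn \<longlonglongrightarrow> t"
  shows "(\<lambda>n. char (Mn n) (tn n)) \<longlonglongrightarrow> char M t"
proof -
  have "(\<lambda>n. char (Mn n) (tn n) - char (Mn n) t) \<longlonglongrightarrow> 0"
  proof (rule tendstoI)
    fix e :: real assume "e > 0"
    then obtain r where r: "r > 0" "\<forall>\<^sub>F n in sequentially. \<forall>s t. \<bar>s - t\<bar> \<le> r \<longrightarrow> norm (char (Mn n) s - char (Mn n) t) \<le> e / 2"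
      using weak_conv_char_equicontinuous[OF Mn M weak, of "e / 2"] by auto
    from r(2) tendstoD[OF t r(1)]
    show "\<forall>\<^sub>F n in sequentially. dist (char (Mn n) (tn n) - char (Mn n) t) 0 < e"
    proof eventually_elim
      case (elim n)
      then have "norm (char (Mn n) (tn n) - char (Mn n) t) \<le> e / 2" by (auto simp: dist_real_def)
      then show ?case using \<open>e > 0\<close> by simp
    qed
  qed
  moreover have "(\<lambda>n. char (Mn n) t) \<longlonglongrightarrow> char M t"
    using levy_continuity1[OF Mn M weak] .
  ultimately have "(\<lambda>n. (char (Mn n) (tn n) - char (Mn n) t) + char (Mn n) t) \<longlonglongrightarrow> 0 + char M t"
    by (rule tendsto_add)
  then show ?thesis by simp
qed

section \<open>Symmetrization and truncated second moments\<close>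

text \<open>
  A single value of \<open>1 - cos (u x)\<close> gives no lower bound for large \<open>x\<close>, since it vanishes at the
  multiples of \<open>2 \<pi> / u\<close>. Averaging over \<open>u\<close> in the unit interval yields \<open>1 - sinc x\<close>, which
  dominates the truncated square.
\<close>

lemma one_minus_sinc_ge: "min (y\<^sup>2) 1 / 8 \<le> 1 - sinc y" for y :: real
proof -
  have pos: "min (y\<^sup>2) 1 / 8 \<le> 1 - sinc y" if y: "y > 0" for y :: real
  proof (cases "y \<le> 2")
    case True
    have "\<bar>sin y - (\<Sum>m<5. sin_coeff m * y ^ m)\<bar> \<le> inverse (fact 5) * \<bar>y\<bar> ^ 5"
      by (rule Maclaurin_sin_bound)
    moreover have "(\<Sum>m<5. sin_coeff m * y ^ m) = y - y ^ 3 / 6"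
      by (simp add: eval_nat_numeral sin_coeff_Suc cos_coeff_Suc)
    moreover have "inverse (fact 5) * \<bar>y\<bar> ^ 5 = y ^ 5 / 120"
      using y by (simp add: fact_numeral)
    ultimately have "sin y \<le> y - y ^ 3 / 6 + y ^ 5 / 120" by linarith
    then have "sin y / y \<le> (y - y ^ 3 / 6 + y ^ 5 / 120) / y"
      using y by (intro divide_right_mono) auto
    also have "\<dots> = 1 - (y\<^sup>2 / 6 - (y\<^sup>2)\<^sup>2 / 120)"
      using y by (simp add: field_simps power_numeral_reduce)
    finally have *: "y\<^sup>2 / 6 - (y\<^sup>2)\<^sup>2 / 120 \<le> 1 - sinc y" using y by simp
    have z: "0 \<le> y\<^sup>2" "y\<^sup>2 \<le> 4" using power_mono[OF True, of 2] y by auto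
    have "min (y\<^sup>2) 1 / 8 \<le> y\<^sup>2 / 6 - (y\<^sup>2)\<^sup>2 / 120"
    proof (cases "y\<^sup>2 \<le> 1")
      case True
      have "y\<^sup>2 * y\<^sup>2 \<le> y\<^sup>2 * 1" using True by (intro mult_left_mono) auto
      then have "(y\<^sup>2)\<^sup>2 \<le> y\<^sup>2" by (simp only: power2_eq_square[of "y\<^sup>2"] mult_1_right)
      moreover have "min (y\<^sup>2) 1 = y\<^sup>2" using True by simp
      ultimately show ?thesis using z(1) by linarith
    next
      case False
      have "0 \<le> (y\<^sup>2 - 1) * (4 - y\<^sup>2)" using z False by simp
      then have "(y\<^sup>2)\<^sup>2 \<le> 5 * y\<^sup>2 - 4" by (simp add: algebra_simps power2_eq_square[of "y\<^sup>2"])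
      then show ?thesis using False z by (simp add: min_def)
    qed
    then show ?thesis using * by linarith
  next
    case False
    then have "sin y * 2 \<le> y" using sin_le_one[of y] by linarith
    then have "sin y / y \<le> 1 / 2" using y by (simp add: divide_le_eq)
    moreover have "min (y\<^sup>2) 1 \<le> 1" by simp
    moreover have "sinc y = sin y / y" using y by simp
    ultimately show ?thesis by linarith
  qed
  show ?thesis
  proof (cases y "0::real" rule: linorder_cases)
    case less
    then show ?thesis using pos[of "- y"] by simp
  qed (use pos in auto)
qed

lemma integral_cos_unit: "(LINT u:{0..1}|lborel. cos (u * y)) = sinc y" for y :: real
proof (cases "y = 0")
  case True
  then show ?thesis by (simp add: set_lebesgue_integral_def)
next
  case False
  have "(LINT u|lborel. cos (u * y) * indicator {0..1} u) = sin (1 * y) / y - sin (0 * y) / y"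
    by (rule integral_FTC_Icc_real) (use False in \<open>auto intro!: derivative_eq_intros continuous_intros\<close>)
  then show ?thesis using False by (simp add: set_lebesgue_integral_def mult.commute)
qed

text \<open>
  Fubini for the average of \<open>cos (u (r x))\<close> over \<open>u\<close> in the unit interval.
\<close>

lemma (in real_distribution) truncated_second_moment_le:
  assumes r: "r > 0" and ch: "\<And>t. 0 \<le> t \<Longrightarrow> t \<le> r \<Longrightarrow> 1 - \<epsilon> \<le> Re (char M t)"
  shows "(LINT x|M. min ((r * x)\<^sup>2) 1) \<le> 8 * \<epsilon>"
proof -
  interpret P: pair_sigma_finite lborel M ..
  let ?f = "\<lambda>(u, x). indicator {0..1} u *\<^sub>R cos (u * (r * x))"
  have fint: "integrable (lborel \<Otimes>\<^sub>M M) ?f"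
  proof (rule P.Fubini_integrable)
    have meas: "(\<lambda>u. LINT x|M. norm (?f (u, x))) \<in> borel_measurable lborel" by measurable
    show "integrable lborel (\<lambda>u. LINT x|M. norm (?f (u, x)))"
    proof (rule Bochner_Integration.integrable_bound[OF _ meas])
      show "integrable lborel (indicator {0..1::real} :: real \<Rightarrow> real)" by simp
      show "AE u in lborel. norm (LINT x|M. norm (?f (u, x))) \<le> norm (indicator {0..1::real} u :: real)"
      proof (rule AE_I2)
        fix u :: real
        have "(LINT x|M. norm (?f (u, x))) \<le> (LINT x|M. indicator {0..1} u)"
          by (intro integral_mono integrable_const_bound[where B = 1]) (auto split: split_indicator)
        then show "norm (LINT x|M. norm (?f (u, x))) \<le> norm (indicator {0..1::real} u :: real)"
          by (simp del: space_eq_univ add: prob_space)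
      qed
    qed
    show "AE u in lborel. integrable M (\<lambda>x. ?f (u, x))"
      by (intro AE_I2 integrable_const_bound[where B = 1]) (auto split: split_indicator)
  qed measurable
  have inner: "(LINT x|M. ?f (u, x)) = indicator {0..1} u *\<^sub>R Re (char M (u * r))" for u
  proof -
    have "Re (char M (u * r)) = (LINT x|M. Re (iexp (u * r * x)))"
      unfolding char_def by (rule integral_Re[symmetric]) (auto intro!: integrable_iexp)
    then show ?thesis by (simp add: Re_exp mult.assoc)
  qed
  have "(LINT u:{0..1::real}|lborel. 1 - \<epsilon>) \<le> (LINT u:{0..1}|lborel. Re (char M (u * r)))"
  proof (rule set_integral_mono)
    show "set_integrable lborel {0..1} (\<lambda>u. Re (char M (u * r)))"
      unfolding set_integrable_def inner[symmetric] by (rule P.integrable_fst'[OF fint])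
    show "1 - \<epsilon> \<le> Re (char M (u * r))" if "u \<in> {0..1}" for u
      using that r by (intro ch) (auto simp: mult_left_le_one_le)
  qed (auto simp: set_integrable_def)
  then have "1 - \<epsilon> \<le> (LINT u|lborel. (LINT x|M. ?f (u, x)))"
    unfolding inner by (simp add: set_lebesgue_integral_def)
  also have "\<dots> = (LINT x|M. (LINT u|lborel. ?f (u, x)))"
    by (rule P.Fubini_integral[symmetric]) (use fint in simp)
  also have "\<dots> = (LINT x|M. sinc (r * x))"
    using integral_cos_unit[of "r * x" for x] by (simp add: set_lebesgue_integral_def)
  finally have *: "1 - \<epsilon> \<le> (LINT x|M. sinc (r * x))" .
  have int: "integrable M (\<lambda>x. sinc (r * x))"
  proof (rule integrable_const_bound[where B = 1])
    show "AE x in M. norm (sinc (r * x)) \<le> 1"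
      using abs_sin_x_le_abs_x by (auto intro!: AE_I2 simp: divide_le_eq)
  qed simp
  have "(LINT x|M. min ((r * x)\<^sup>2) 1 / 8) \<le> (LINT x|M. 1 - sinc (r * x))"
  proof (rule integral_mono)
    show "integrable M (\<lambda>x. min ((r * x)\<^sup>2) 1 / 8)"
      by (intro integrable_const_bound[where B = 1]) auto
    show "integrable M (\<lambda>x. 1 - sinc (r * x))"
      by (intro Bochner_Integration.integrable_diff int) simp
  qed (rule one_minus_sinc_ge)
  also have "\<dots> = 1 - (LINT x|M. sinc (r * x))" using int by (simp del: space_eq_univ add: prob_space)
  finally show ?thesis using * by simp
qed

definition symmetrization :: "real measure \<Rightarrow> real measure" where
  "symmetrization M = distr (M \<Otimes>\<^sub>M M) borel (\<lambda>(x, y). x - y)"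

context real_distribution
begin

lemma real_distribution_symmetrization: "real_distribution (symmetrization M)"
proof -
  interpret P: pair_prob_space M M ..
  show ?thesis unfolding symmetrization_def
    by (rule P.real_distribution_distr) measurable
qed

lemma char_symmetrization: "char (symmetrization M) t = of_real ((norm (char M t))\<^sup>2)"
proof -
  interpret P: pair_prob_space M M ..
  have "char (symmetrization M) t = (CLINT p|(M \<Otimes>\<^sub>M M). iexp (t * (fst p - snd p)))"
    unfolding symmetrization_def char_def by (subst integral_distr) (auto simp: split_beta)
  also have "\<dots> = (CLINT p|(M \<Otimes>\<^sub>M M). (\<lambda>(x, y). iexp (t * x) * iexp (- t * y)) p)"
    by (intro Bochner_Integration.integral_cong) (auto simp: exp_add[symmetric] algebra_simps)
  also have "\<dots> = (CLINT x|M. (CLINT y|M. iexp (t * x) * iexp (- t * y)))"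
    by (subst P.integral_fst'[symmetric])
       (auto intro!: P.integrable_const_bound[where B = 1] simp: split_beta norm_mult)
  also have "\<dots> = char M t * char M (- t)"
    unfolding char_def by simp
  finally show ?thesis by (simp add: char_uminus complex_norm_square del: of_real_power)
qed

lemma eq_return_if_AE_eq:
  assumes c: "AE y in M. c = y"
  shows "M = return borel c"
proof (rule measure_eqI)
  fix A assume A: "A \<in> sets M"
  have "emeasure M A = (if c \<in> A then 1 else 0)"
  proof (cases "c \<in> A")
    case True
    have "emeasure M A = emeasure M (space M)"
      using c True A by (intro emeasure_eq_AE) auto
    then show ?thesis using True emeasure_space_1 by simp
  next
    case False
    have "emeasure M A = emeasure M {}"
      using c False A by (intro emeasure_eq_AE) auto
    then show ?thesis using False by simp
  qed
  then show "emeasure M A = emeasure (return borel c) A" using A by (simp add: indicator_def)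
qed simp

lemma degenerate_if_symmetrization_zero:
  assumes "(LINT x|symmetrization M. min (x\<^sup>2) 1) = 0"
  shows "\<exists>c. M = return borel c"
proof -
  interpret P: pair_prob_space M M ..
  interpret D: real_distribution "symmetrization M" by (rule real_distribution_symmetrization)
  have "AE x in symmetrization M. min (x\<^sup>2) 1 = 0"
    using assms by (subst (asm) integral_nonneg_eq_0_iff_AE)
      (auto intro!: D.integrable_const_bound[where B = 1])
  then have "AE x in symmetrization M. x = 0"
    by eventually_elim (auto simp: min_def split: if_splits)
  then have "AE p in M \<Otimes>\<^sub>M M. fst p = snd p"
    unfolding symmetrization_def by (subst (asm) AE_distr_iff) (auto simp: split_beta)
  then have diag: "AE x in M. AE y in M. x = y"
    by (intro P.AE_pair[of "\<lambda>p. fst p = snd p", simplified]) auto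
  have "\<exists>c. AE y in M. c = y"
  proof (rule ccontr)
    assume "\<nexists>c. AE y in M. c = y"
    then have "AE x in M. False" using diag by simp
    then show False by simp
  qed
  then obtain c where c: "AE y in M. c = y" by blast
  then show ?thesis using eq_return_if_AE_eq by blast
qed

text \<open>
  With \<open>\<epsilon> = 0\<close>, the bound on the truncated second moment shows that the difference of two
  independent copies vanishes.
\<close>

lemma degenerate_if_norm_char_1:
  assumes "\<And>t. norm (char M t) = 1"
  shows "\<exists>c. M = return borel c"
proof (rule degenerate_if_symmetrization_zero)
  interpret D: real_distribution "symmetrization M" by (rule real_distribution_symmetrization)
  have "(LINT x|symmetrization M. min ((1 * x)\<^sup>2) 1) \<le> 8 * 0"
    by (rule D.truncated_second_moment_le) (simp_all add: char_symmetrization assms)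
  moreover have "(LINT x|symmetrization M. min ((1 * x)\<^sup>2) 1) \<ge> 0" by simp
  ultimately have "(LINT x|symmetrization M. min ((1 * x)\<^sup>2) 1) = 0" by linarith
  then show "(LINT x|symmetrization M. min (x\<^sup>2) 1) = 0" by simp
qed

text \<open>
  Desymmetrization: where the second copy lies in a bounded interval, of mass more than one
  half, the difference of the copies and the first copy are a bounded distance apart.
\<close>

lemma truncated_second_moment_le_symmetrization:
  "\<exists>m. \<forall>u. (LINT x|M. min ((u * x)\<^sup>2) 1)
     \<le> 4 * (LINT x|symmetrization M. min ((u * x)\<^sup>2) 1) + m * u\<^sup>2"
proof -
  interpret P: pair_prob_space M M ..
  have "(\<lambda>k. measure M {- real k..real k}) \<longlonglongrightarrow> measure M (\<Union>k. {- real k..real k})"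
    by (rule finite_Lim_measure_incseq) (auto simp: incseq_def)
  also have "(\<Union>k. {- real k..real k}) = UNIV"
  proof (intro equalityI subset_UNIV subsetI)
    fix x :: real
    obtain k where "\<bar>x\<bar> \<le> real k" using real_arch_simple by blast
    then have "x \<in> {- real k..real k}" by auto
    then show "x \<in> (\<Union>k. {- real k..real k})" by blast
  qed
  also have "measure M UNIV = 1" using prob_space by simp
  finally have "\<forall>\<^sub>F k in sequentially. measure M {- real k..real k} > 1 / 2"
    by (rule order_tendstoD) simp
  then obtain k where k: "measure M {- real k..real k} > 1 / 2" by (auto simp: eventually_sequentially)
  let ?I = "{- real k..real k}"
  have "(LINT x|M. min ((u * x)\<^sup>2) 1)
     \<le> 4 * (LINT x|symmetrization M. min ((u * x)\<^sup>2) 1) + 4 * (real k)\<^sup>2 * u\<^sup>2" for u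
  proof -
    let ?K = "LINT x|M. min ((u * x)\<^sup>2) 1"
    have K: "?K \<ge> 0" by simp
    have aux: "min a 1 \<le> 2 * min d 1 + k" if "a \<le> 2 * d + k" "0 \<le> k" "0 \<le> d" for a d k :: real
      using that by (auto simp: min_def)
    have pt: "min ((u * x)\<^sup>2) 1 * indicator ?I y
       \<le> 2 * min ((u * (x - y))\<^sup>2) 1 + 2 * ((real k)\<^sup>2 * u\<^sup>2)" for x y
    proof (cases "y \<in> ?I")
      case True
      have "(u * x)\<^sup>2 \<le> 2 * (u * (x - y))\<^sup>2 + 2 * (u * y)\<^sup>2"
        using zero_le_power2[of "u * (x - y) - u * y"] by (simp add: power2_eq_square algebra_simps)
      moreover have "(u * y)\<^sup>2 \<le> (real k)\<^sup>2 * u\<^sup>2"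
      proof -
        have "y\<^sup>2 \<le> (real k)\<^sup>2" using True abs_le_square_iff[of y "real k"] by (simp add: abs_le_iff)
        then have "y\<^sup>2 * u\<^sup>2 \<le> (real k)\<^sup>2 * u\<^sup>2" by (rule mult_right_mono) simp
        then show ?thesis by (simp add: power_mult_distrib mult.commute)
      qed
      ultimately have "(u * x)\<^sup>2 \<le> 2 * (u * (x - y))\<^sup>2 + 2 * ((real k)\<^sup>2 * u\<^sup>2)" by linarith
      moreover have "0 \<le> (real k)\<^sup>2 * u\<^sup>2" "0 \<le> (u * (x - y))\<^sup>2" by simp_all
      ultimately have "min ((u * x)\<^sup>2) 1 \<le> 2 * min ((u * (x - y))\<^sup>2) 1 + 2 * ((real k)\<^sup>2 * u\<^sup>2)"
        by (intro aux) auto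
      then show ?thesis using True by simp
    qed simp
    have min_int: "integrable (M \<Otimes>\<^sub>M M) (\<lambda>p. min ((u * (fst p - snd p))\<^sup>2) 1)"
      by (rule P.integrable_const_bound[where B = 1]) auto
    have "?K * (1 / 2) \<le> ?K * measure M ?I"
      using K k by (intro mult_left_mono) auto
    also have "\<dots> = (LINT x|M. (LINT y|M. min ((u * x)\<^sup>2) 1 * indicator ?I y))"
      by simp
    also have "\<dots> = (LINT p|(M \<Otimes>\<^sub>M M). (\<lambda>(x, y). min ((u * x)\<^sup>2) 1 * indicator ?I y) p)"
      by (subst P.integral_fst'[symmetric])
         (auto intro!: P.integrable_const_bound[where B = 1] simp: split_beta split: split_indicator)
    also have "\<dots> \<le> (LINT p|(M \<Otimes>\<^sub>M M). 2 * min ((u * (fst p - snd p))\<^sup>2) 1 + 2 * ((real k)\<^sup>2 * u\<^sup>2))"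
    proof (rule integral_mono)
      show "integrable (M \<Otimes>\<^sub>M M) (\<lambda>(x, y). min ((u * x)\<^sup>2) 1 * indicator ?I y)"
        by (rule P.integrable_const_bound[where B = 1]) (auto simp: split_beta split: split_indicator)
      show "integrable (M \<Otimes>\<^sub>M M) (\<lambda>p. 2 * min ((u * (fst p - snd p))\<^sup>2) 1 + 2 * ((real k)\<^sup>2 * u\<^sup>2))"
        by (intro Bochner_Integration.integrable_add integrable_mult_right min_int) simp_all
    qed (use pt in \<open>auto simp: split_beta\<close>)
    also have "\<dots> = 2 * (LINT p|(M \<Otimes>\<^sub>M M). min ((u * (fst p - snd p))\<^sup>2) 1) + 2 * ((real k)\<^sup>2 * u\<^sup>2)"
      using P.prob_space by (subst Bochner_Integration.integral_add) (auto intro: min_int)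
    also have "(LINT p|(M \<Otimes>\<^sub>M M). min ((u * (fst p - snd p))\<^sup>2) 1) = (LINT x|symmetrization M. min ((u * x)\<^sup>2) 1)"
      unfolding symmetrization_def by (subst integral_distr) (auto simp: split_beta)
    finally show ?thesis by simp
  qed
  then show ?thesis by blast
qed

end

text \<open>
  If \<open>norm (char \<nu> (t / b n)) ^ n\<close> stays away from 0 for small \<open>t\<close>, then
  \<open>1 - (norm (char \<nu> (t / b n)))\<^sup>2\<close> is of order \<open>1 / n\<close>, uniformly in such \<open>t\<close>; this is the real
  part of one minus the characteristic function of the symmetrization. Nondegeneracy of \<open>\<nu>\<close> then
  bounds \<open>n / (b n)\<^sup>2\<close>, which absorbs the error term of the desymmetrization.
\<close>

lemma truncated_second_moment_bound:
  assumes \<nu>: "real_distribution \<nu>" and nondeg: "\<nexists>c. \<nu> = return borel c"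
    and Mn: "\<And>n. real_distribution (Mn n)" and M: "real_distribution M"
    and weak: "weak_conv_m Mn M"
    and b: "\<And>n. b n > 0"
    and ch: "\<And>n t. norm (char (Mn n) t) = norm (char \<nu> (t / b n)) ^ n"
  shows "\<exists>C. \<forall>\<^sub>F n in sequentially. real n * (LINT x|\<nu>. min ((x / b n)\<^sup>2) 1) \<le> C"
proof -
  interpret real_distribution \<nu> by fact
  interpret D: real_distribution "symmetrization \<nu>" by (rule real_distribution_symmetrization)
  let ?D = "symmetrization \<nu>"
  have min_int: "integrable ?D (\<lambda>x. min ((f x)\<^sup>2) 1)" if "f \<in> borel_measurable ?D" for f :: "real \<Rightarrow> real"
    using that by (intro D.integrable_const_bound[where B = 1]) auto
  obtain r0 where r0: "r0 > 0" "\<forall>\<^sub>F n in sequentially. \<forall>s t. \<bar>s - t\<bar> \<le> r0 \<longrightarrow> norm (char (Mn n) s - char (Mn n) t) \<le> 1 / 2"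
    using weak_conv_char_equicontinuous[OF Mn M weak, of "1 / 2"] by auto
  define r where "r = min r0 1"
  have r: "0 < r" "r \<le> 1" "r \<le> r0" using r0 by (auto simp: r_def)
  define C where "C = 16 / r\<^sup>2"
  have C: "C > 0" using r by (simp add: C_def)
  from r0(2) have D: "\<forall>\<^sub>F n in sequentially. real n * (LINT x|?D. min ((1 / b n * x)\<^sup>2) 1) \<le> C"
    using eventually_gt_at_top[of 0]
  proof eventually_elim
    case (elim n)
    have "1 - 2 / real n \<le> Re (char ?D t)" if t: "0 \<le> t" "t \<le> r / b n" for t
    proof -
      define w where "w = 1 - (norm (char \<nu> t))\<^sup>2"
      have w: "0 \<le> 1 - w" by (simp add: w_def)
      have "\<bar>b n * t\<bar> \<le> r" using t b[of n] by (simp add: field_simps)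
      then have "norm (char (Mn n) 0 - char (Mn n) (b n * t)) \<le> 1 / 2"
        using elim(1) r by auto
      then have "norm (char (Mn n) (b n * t)) \<ge> 1 / 2"
        using norm_triangle_ineq2[of 1 "1 - char (Mn n) (b n * t)"] real_distribution.char_zero[OF Mn] by simp
      then have "norm (char \<nu> t) ^ n \<ge> 1 / 2" using b[of n] by (simp add: ch)
      then have "(norm (char \<nu> t) ^ n)\<^sup>2 \<ge> (1 / 2)\<^sup>2" by (intro power_mono) auto
      then have "(1 - w) ^ n \<ge> 1 / 4" by (simp add: w_def power_even_eq power2_eq_square flip: power_mult power_mult_distrib)
      moreover have "(1 - w) ^ n \<le> exp (- w) ^ n"
        using w exp_ge_add_one_self[of "- w"] by (intro power_mono) auto
      moreover have "exp (- w) ^ n = exp (- (real n * w))" by (simp flip: exp_of_nat_mult)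
      moreover have "exp (-2) < (1 / 4 :: real)"
        using exp_lower_Taylor_quadratic[of "2::real"] by (simp add: exp_minus field_simps)
      ultimately have "exp (-2) \<le> exp (- (real n * w))" by linarith
      then have "real n * w \<le> 2" by simp
      then have "w \<le> 2 / real n" using elim by (simp add: field_simps)
      then show ?thesis unfolding char_symmetrization w_def by simp
    qed
    then have le: "(LINT x|?D. min ((r / b n * x)\<^sup>2) 1) \<le> 8 * (2 / real n)"
      using r b[of n] by (intro D.truncated_second_moment_le) auto
    have "r\<^sup>2 * (LINT x|?D. min ((1 / b n * x)\<^sup>2) 1) = (LINT x|?D. r\<^sup>2 * min ((1 / b n * x)\<^sup>2) 1)"
      by simp
    also have "\<dots> \<le> (LINT x|?D. min ((r / b n * x)\<^sup>2) 1)"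
    proof (rule integral_mono)
      show "r\<^sup>2 * min ((1 / b n * x)\<^sup>2) 1 \<le> min ((r / b n * x)\<^sup>2) 1" for x
      proof (rule min.boundedI)
        have "r\<^sup>2 * min ((1 / b n * x)\<^sup>2) 1 \<le> r\<^sup>2 * (1 / b n * x)\<^sup>2" by (intro mult_left_mono) auto
        then show "r\<^sup>2 * min ((1 / b n * x)\<^sup>2) 1 \<le> (r / b n * x)\<^sup>2"
          by (simp add: power_mult_distrib power_divide)
        have "r\<^sup>2 * min ((1 / b n * x)\<^sup>2) 1 \<le> 1 * 1"
          using r by (intro mult_mono) (auto simp: power_le_one)
        then show "r\<^sup>2 * min ((1 / b n * x)\<^sup>2) 1 \<le> 1" by simp
      qed
    qed (auto intro!: min_int integrable_mult_right)
    finally have "r\<^sup>2 * (LINT x|?D. min ((1 / b n * x)\<^sup>2) 1) \<le> 16 / real n" using le by simp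
    then show ?case using elim r by (simp add: C_def field_simps)
  qed
  define c where "c = (LINT x|?D. min (x\<^sup>2) 1)"
  have c: "c > 0"
  proof -
    have "c \<ge> 0" by (simp add: c_def)
    moreover have "c \<noteq> 0" using degenerate_if_symmetrization_zero nondeg unfolding c_def by blast
    ultimately show ?thesis by simp
  qed
  from D have B: "\<forall>\<^sub>F n in sequentially. real n * (1 / b n)\<^sup>2 \<le> C / c"
    using eventually_gt_at_top[of "nat \<lceil>C / c\<rceil>"]
  proof eventually_elim
    case (elim n)
    have n: "real n * c > C" 
    proof -
      have "C / c < real n" using elim(2) by linarith
      then show ?thesis using c by (simp add: field_simps)
    qed
    have *: "q * c \<le> (LINT x|?D. min ((1 / b n * x)\<^sup>2) 1)" if q: "0 \<le> q" "q \<le> 1" "q \<le> (1 / b n)\<^sup>2" for q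
    proof -
      have "q * c = (LINT x|?D. q * min (x\<^sup>2) 1)" by (simp add: c_def)
      also have "\<dots> \<le> (LINT x|?D. min ((1 / b n * x)\<^sup>2) 1)"
      proof (rule integral_mono)
        show "q * min (x\<^sup>2) 1 \<le> min ((1 / b n * x)\<^sup>2) 1" for x
        proof -
          have "q * min (x\<^sup>2) 1 \<le> (1 / b n)\<^sup>2 * x\<^sup>2" using q by (intro mult_mono) auto
          moreover have "q * min (x\<^sup>2) 1 \<le> 1 * 1" using q by (intro mult_mono) auto
          ultimately show ?thesis by (simp add: power_mult_distrib power_divide)
        qed
      qed (auto intro!: min_int integrable_mult_right)
      finally show ?thesis .
    qed
    show ?case
    proof (cases "(1 / b n)\<^sup>2 \<le> 1")
      case True
      have "real n * ((1 / b n)\<^sup>2 * c) \<le> real n * (LINT x|?D. min ((1 / b n * x)\<^sup>2) 1)"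
        using *[of "(1 / b n)\<^sup>2"] True by (intro mult_left_mono) auto
      then have "real n * ((1 / b n)\<^sup>2 * c) \<le> C" using elim(1) by linarith
      then show ?thesis using c by (simp add: field_simps)
    next
      case False
      have "real n * (1 * c) \<le> real n * (LINT x|?D. min ((1 / b n * x)\<^sup>2) 1)"
        using *[of 1] False by (intro mult_left_mono) auto
      then show ?thesis using elim(1) n by linarith
    qed
  qed
  obtain m where m: "\<And>u. (LINT x|\<nu>. min ((u * x)\<^sup>2) 1)
     \<le> 4 * (LINT x|symmetrization \<nu>. min ((u * x)\<^sup>2) 1) + m * u\<^sup>2"
    using truncated_second_moment_le_symmetrization by blast
  have "\<forall>\<^sub>F n in sequentially. real n * (LINT x|\<nu>. min ((x / b n)\<^sup>2) 1) \<le> 4 * C + \<bar>m\<bar> * (C / c)"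
    using D B
  proof eventually_elim
    case (elim n)
    have "real n * (LINT x|\<nu>. min ((x / b n)\<^sup>2) 1)
       \<le> real n * (4 * (LINT x|?D. min ((1 / b n * x)\<^sup>2) 1) + m * (1 / b n)\<^sup>2)"
      using m[of "1 / b n"] by (intro mult_left_mono) auto
    also have "\<dots> = 4 * (real n * (LINT x|?D. min ((1 / b n * x)\<^sup>2) 1)) + m * (real n * (1 / b n)\<^sup>2)"
      by (simp add: algebra_simps)
    also have "\<dots> \<le> 4 * C + \<bar>m\<bar> * (C / c)"
      using elim by (intro add_mono mult_left_mono mult_mono) auto
    finally show ?case .
  qed
  then show ?thesis by blast
qed

section \<open>Growth of the norming constants\<close>

lemma weak_conv_m_subseq: "weak_conv_m Mn M \<Longrightarrow> strict_mono r \<Longrightarrow> weak_conv_m (\<lambda>n. Mn (r n)) M"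
  unfolding weak_conv_m_def weak_conv_def
  using LIMSEQ_subseq_LIMSEQ[of "\<lambda>n. cdf (Mn n) x" _ r for x] by (auto simp: comp_def)

text \<open>
  Suppose \<open>b (2 n) > \<rho> b n\<close> infinitely often. A limit point \<open>q0 \<le> 1 / \<rho>\<close> of the ratios
  \<open>b n / b (2 n)\<close> then satisfies \<open>norm (char M t) = norm (char M (\<kappa> q0 t))\<close> with \<open>\<kappa> q0 < 1\<close>.
  Iteration drives the argument to 0, so the modulus is identically 1 and \<open>M\<close> is degenerate.
\<close>

lemma norming_growth:
  assumes Mn: "\<And>n. real_distribution (Mn n)" and M: "real_distribution M"
    and weak: "weak_conv_m Mn M" and nondeg: "\<nexists>c. M = return borel c"
    and b: "\<And>n. b n > 0"
    and ch: "\<And>n t. norm (char (Mn n) t) = norm (char \<nu> (t / b n)) ^ n"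
    and stable: "\<And>t. (norm (char M t))\<^sup>2 = norm (char M (\<kappa> * t))"
    and \<kappa>: "0 < \<kappa>" "\<kappa> < \<rho>"
  shows "\<forall>\<^sub>F n in sequentially. b (2 * n) \<le> \<rho> * b n"
proof (rule ccontr)
  assume "\<not> ?thesis"
  then obtain r :: "nat \<Rightarrow> nat" where r: "strict_mono r" "\<And>n. \<rho> * b (r n) < b (2 * r n)"
    using not_eventually_sequentiallyD by (metis (no_types, lifting) linorder_not_le)
  define q where "q n = b (r n) / b (2 * r n)" for n
  have q: "q n \<in> {0..1 / \<rho>}" for n
    using r(2)[of n] b[of "r n"] b[of "2 * r n"] \<kappa> by (simp add: q_def field_simps)
  obtain q0 s where s: "q0 \<in> {0..1 / \<rho>}" "strict_mono s" "(q \<circ> s) \<longlonglongrightarrow> q0"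
    using compact_Icc[of 0 "1 / \<rho>"] q unfolding compact_def by metis
  define k where "k n = r (s n)" for n
  have k: "strict_mono k" unfolding k_def using r(1) s(2) by (simp add: strict_mono_def)
  interpret real_distribution M by fact
  let ?g = "\<lambda>t. norm (char M t)"
  have "?g t = ?g (\<kappa> * q0 * t)" for t
  proof -
    have eq: "norm (char (Mn (2 * k n)) t) = (norm (char (Mn (k n)) (t * q (s n))))\<^sup>2" for n
    proof -
      have "t * q (s n) / b (k n) = t / b (2 * k n)"
        using b[of "k n"] by (simp add: q_def k_def)
      then show ?thesis by (simp add: ch power_mult[symmetric] mult.commute)
    qed
    have "strict_mono (\<lambda>n. 2 * k n)" using k by (simp add: strict_mono_def)
    then have "(\<lambda>n. norm (char (Mn (2 * k n)) t)) \<longlonglongrightarrow> ?g t"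
      by (intro tendsto_norm levy_continuity1[OF _ M] weak_conv_m_subseq[OF weak] Mn)
    moreover have "(\<lambda>n. (norm (char (Mn (k n)) (t * q (s n))))\<^sup>2) \<longlonglongrightarrow> (?g (t * q0))\<^sup>2"
      using s(3) by (intro tendsto_power tendsto_norm weak_conv_char_continuous[OF _ M]
          weak_conv_m_subseq[OF weak k] Mn tendsto_intros) (simp add: comp_def)
    ultimately have "?g t = (?g (t * q0))\<^sup>2" unfolding eq by (rule LIMSEQ_unique)
    then show ?thesis by (simp add: stable mult_ac)
  qed
  then have iter: "?g t = ?g ((\<kappa> * q0) ^ j * t)" for t j
    by (induction j) (auto simp: mult.assoc)
  have "0 \<le> \<kappa> * q0" "\<kappa> * q0 < 1"
  proof -
    have "\<kappa> * q0 \<le> \<kappa> * (1 / \<rho>)" using s(1) \<kappa> by (intro mult_left_mono) auto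
    also have "\<dots> < 1" using \<kappa> by simp
    finally show "\<kappa> * q0 < 1" .
  qed (use s(1) \<kappa> in auto)
  then have pow: "(\<lambda>j. (\<kappa> * q0) ^ j) \<longlonglongrightarrow> 0" by (intro LIMSEQ_realpow_zero)
  have "?g t = 1" for t
  proof -
    have "(\<lambda>j. (\<kappa> * q0) ^ j * t) \<longlonglongrightarrow> 0 * t" by (intro tendsto_intros pow)
    then have "(\<lambda>j. ?g ((\<kappa> * q0) ^ j * t)) \<longlonglongrightarrow> ?g (0 * t)"
      by (intro tendsto_norm isCont_tendsto_compose[OF isCont_char])
    then have "(\<lambda>j. ?g t) \<longlonglongrightarrow> 1" using iter[of t] by (simp add: char_zero)
    then show ?thesis by (simp add: LIMSEQ_const_iff)
  qed
  then show False using degenerate_if_norm_char_1 nondeg by blast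
qed

section \<open>Truncated first moments\<close>

text \<open>
  Since \<open>exp (- x) - 1 + x\<close> is at most \<open>min (x\<^sup>2) x\<close> for \<open>x \<ge> 0\<close>, it bounds the excess of the
  Laplace transform of a nonnegative variable at \<open>s\<close> over its linear approximation.
\<close>

definition truncated_moment :: "real measure \<Rightarrow> real \<Rightarrow> real" where
  "truncated_moment M s = (LINT y|M. min ((s * y)\<^sup>2) (s * \<bar>y\<bar>))"

lemma min_square_abs_step:
  fixes x \<rho> :: real assumes "\<rho> > 1"
  shows "min (x\<^sup>2) \<bar>x\<bar> \<le> \<rho> * min ((x / \<rho>)\<^sup>2) (\<bar>x\<bar> / \<rho>) + \<rho> * min (x\<^sup>2) 1"
proof (cases "\<bar>x\<bar> \<ge> \<rho>")
  case True
  then have "1 \<le> \<bar>x\<bar> / \<rho>" using assms by simp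
  then have "(\<bar>x\<bar> / \<rho>) * 1 \<le> (\<bar>x\<bar> / \<rho>) * (\<bar>x\<bar> / \<rho>)" by (intro mult_left_mono) auto
  then have "\<bar>x\<bar> / \<rho> \<le> (x / \<rho>)\<^sup>2" by (simp add: power2_eq_square)
  then have "\<rho> * min ((x / \<rho>)\<^sup>2) (\<bar>x\<bar> / \<rho>) = \<bar>x\<bar>" using assms by simp
  moreover have "0 \<le> \<rho> * min (x\<^sup>2) 1" using assms by simp
  ultimately show ?thesis by linarith
next
  case False
  have "min (x\<^sup>2) \<bar>x\<bar> \<le> \<rho> * min (x\<^sup>2) 1"
  proof (cases "x\<^sup>2 \<le> 1")
    case True
    have "1 * x\<^sup>2 \<le> \<rho> * x\<^sup>2" using assms by (intro mult_right_mono) auto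
    then show ?thesis using True by simp
  qed (use False in simp)
  moreover have "0 \<le> \<rho> * min ((x / \<rho>)\<^sup>2) (\<bar>x\<bar> / \<rho>)" using assms by simp
  ultimately show ?thesis by linarith
qed

context real_distribution
begin

lemma integrable_truncated:
  assumes "integrable M (\<lambda>y. y)" and "s \<ge> 0"
  shows "integrable M (\<lambda>y. min ((s * y)\<^sup>2) (s * \<bar>y\<bar>))"
proof (rule Bochner_Integration.integrable_bound)
  show "integrable M (\<lambda>y. s * \<bar>y\<bar>)" using assms by simp
  show "AE y in M. norm (min ((s * y)\<^sup>2) (s * \<bar>y\<bar>)) \<le> norm (s * \<bar>y\<bar>)"
    using assms by (intro AE_I2) (auto simp: min_def)
qed simp

lemma truncated_moment_mono:
  assumes int: "integrable M (\<lambda>y. y)" and s: "0 \<le> s" "s \<le> t"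
  shows "truncated_moment M s \<le> truncated_moment M t"
  unfolding truncated_moment_def
proof (rule integral_mono)
  show "min ((s * y)\<^sup>2) (s * \<bar>y\<bar>) \<le> min ((t * y)\<^sup>2) (t * \<bar>y\<bar>)" for y
  proof (rule min.mono)
    show "(s * y)\<^sup>2 \<le> (t * y)\<^sup>2"
      unfolding power_mult_distrib using s by (intro mult_right_mono power_mono) simp_all
    show "s * \<bar>y\<bar> \<le> t * \<bar>y\<bar>" using s by (intro mult_right_mono) simp_all
  qed
qed (rule integrable_truncated[OF int], use assms in simp)+

lemma truncated_moment_scale:
  assumes int: "integrable M (\<lambda>y. y)" and s: "0 \<le> s" and c: "1 \<le> c"
  shows "truncated_moment M (c * s) \<le> c\<^sup>2 * truncated_moment M s"
proof -
  have "truncated_moment M (c * s) \<le> (LINT y|M. c\<^sup>2 * min ((s * y)\<^sup>2) (s * \<bar>y\<bar>))"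
    unfolding truncated_moment_def
  proof (rule integral_mono)
    have "c \<le> c\<^sup>2" using c by (simp add: power2_eq_square)
    then have "c * s * \<bar>y\<bar> \<le> c\<^sup>2 * (s * \<bar>y\<bar>)" for y
      using s unfolding mult.assoc by (intro mult_right_mono) auto
    then have "min ((c * s * y)\<^sup>2) (c * s * \<bar>y\<bar>) \<le> min (c\<^sup>2 * (s * y)\<^sup>2) (c\<^sup>2 * (s * \<bar>y\<bar>))" for y
      by (rule min.mono[rotated]) (simp add: power_mult_distrib)
    then show "min ((c * s * y)\<^sup>2) (c * s * \<bar>y\<bar>) \<le> c\<^sup>2 * min ((s * y)\<^sup>2) (s * \<bar>y\<bar>)" for y
      by (simp only: mult_min_right[OF zero_le_power2])
  qed (intro integrable_mult_right integrable_truncated int, use s c in simp)+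
  then show ?thesis by (simp add: truncated_moment_def)
qed

text \<open>
  One step trades a truncation at level 1 for one at level \<open>\<rho>\<close>; the mass in between is paid for
  by the truncated second moment.
\<close>

lemma truncated_moment_recursion:
  assumes int: "integrable M (\<lambda>y. y)" and s: "s > 0" and \<rho>: "\<rho> > 1"
  shows "truncated_moment M s \<le> \<rho> ^ j * truncated_moment M (s / \<rho> ^ j)
     + (\<Sum>i<j. \<rho> * \<rho> ^ i * (LINT y|M. min ((s / \<rho> ^ i * y)\<^sup>2) 1))"
proof (induction j)
  case (Suc j)
  have step: "truncated_moment M u \<le> \<rho> * truncated_moment M (u / \<rho>) + \<rho> * (LINT y|M. min ((u * y)\<^sup>2) 1)"
    if u: "u > 0" for u
  proof -
    have i1: "integrable M (\<lambda>y. min ((u / \<rho> * y)\<^sup>2) (u / \<rho> * \<bar>y\<bar>))"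
      using u \<rho> by (intro integrable_truncated int) simp
    have i2: "integrable M (\<lambda>y. min ((u * y)\<^sup>2) 1)"
      by (rule integrable_const_bound[where B = 1]) auto
    have "truncated_moment M u \<le>
        (LINT y|M. \<rho> * min ((u / \<rho> * y)\<^sup>2) (u / \<rho> * \<bar>y\<bar>) + \<rho> * min ((u * y)\<^sup>2) 1)"
      unfolding truncated_moment_def
    proof (rule integral_mono)
      show "integrable M (\<lambda>y. \<rho> * min ((u / \<rho> * y)\<^sup>2) (u / \<rho> * \<bar>y\<bar>) + \<rho> * min ((u * y)\<^sup>2) 1)"
        by (intro Bochner_Integration.integrable_add integrable_mult_right i1 i2)
      show "min ((u * y)\<^sup>2) (u * \<bar>y\<bar>) \<le> \<rho> * min ((u / \<rho> * y)\<^sup>2) (u / \<rho> * \<bar>y\<bar>) + \<rho> * min ((u * y)\<^sup>2) 1" for y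
        using min_square_abs_step[OF \<rho>, of "u * y"] u by (simp add: abs_mult)
    qed (intro integrable_truncated int, use u in simp)
    also have "\<dots> = \<rho> * truncated_moment M (u / \<rho>) + \<rho> * (LINT y|M. min ((u * y)\<^sup>2) 1)"
      unfolding truncated_moment_def
      by (subst Bochner_Integration.integral_add[OF integrable_mult_right[OF i1] integrable_mult_right[OF i2]]) simp
    finally show ?thesis .
  qed
  have "\<rho> ^ j * truncated_moment M (s / \<rho> ^ j) \<le>
     \<rho> ^ j * (\<rho> * truncated_moment M (s / \<rho> ^ j / \<rho>) + \<rho> * (LINT y|M. min ((s / \<rho> ^ j * y)\<^sup>2) 1))"
    using \<rho> s by (intro mult_left_mono step) auto
  then show ?case using Suc by (simp add: algebra_simps)
qed simp

lemma truncated_moment_vanishes: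
  assumes int: "integrable M (\<lambda>y. y)" and s: "s > 0" and \<rho>: "\<rho> > 1"
  shows "(\<lambda>j. \<rho> ^ j * truncated_moment M (s / \<rho> ^ j)) \<longlonglongrightarrow> 0"
proof -
  let ?f = "\<lambda>j y. \<rho> ^ j * min ((s / \<rho> ^ j * y)\<^sup>2) (s / \<rho> ^ j * \<bar>y\<bar>)"
  have pos: "\<rho> ^ j > 0" for j using \<rho> by simp
  have f1: "?f j y \<le> s * \<bar>y\<bar>" for j y
  proof -
    have "?f j y \<le> \<rho> ^ j * (s / \<rho> ^ j * \<bar>y\<bar>)" using pos[of j] by (intro mult_left_mono) auto
    then show ?thesis using pos[of j] \<rho> by (auto split: if_splits)
  qed
  have f2: "?f j y \<le> (s * y)\<^sup>2 * (1 / \<rho>) ^ j" for j y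
  proof -
    have "?f j y \<le> \<rho> ^ j * ((s / \<rho> ^ j * y)\<^sup>2)" using pos[of j] by (intro mult_left_mono) auto
    also have "\<dots> = (s * y)\<^sup>2 * (1 / \<rho>) ^ j"
      using \<rho> by (simp add: power2_eq_square power_one_over field_simps)
    finally show ?thesis .
  qed
  have f0: "?f j y \<ge> 0" for j y using pos[of j] s by simp
  have "(\<lambda>j. LINT y|M. ?f j y) \<longlonglongrightarrow> (LINT y|M. 0)"
  proof (rule integral_dominated_convergence[where w = "\<lambda>y. s * \<bar>y\<bar>"])
    show "AE y in M. (\<lambda>j. ?f j y) \<longlonglongrightarrow> 0"
    proof (rule AE_I2)
      fix y
      have "(\<lambda>j. (s * y)\<^sup>2 * (1 / \<rho>) ^ j) \<longlonglongrightarrow> (s * y)\<^sup>2 * 0"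
        using \<rho> by (intro tendsto_intros LIMSEQ_realpow_zero) auto
      then have "(\<lambda>j. (s * y)\<^sup>2 * (1 / \<rho>) ^ j) \<longlonglongrightarrow> 0" by simp
      then show "(\<lambda>j. ?f j y) \<longlonglongrightarrow> 0"
        by (rule Lim_null_comparison[rotated]) (intro always_eventually allI, unfold real_norm_def abs_of_nonneg[OF f0], rule f2)
    qed
    show "AE y in M. norm (?f j y) \<le> s * \<bar>y\<bar>" for j
      by (intro AE_I2) (unfold real_norm_def abs_of_nonneg[OF f0], rule f1)
    show "(\<lambda>y. ?f j y) \<in> borel_measurable M" for j by measurable
    show "integrable M (\<lambda>y. s * \<bar>y\<bar>)" using int by simp
  qed simp
  moreover have "(LINT y|M. ?f j y) = \<rho> ^ j * truncated_moment M (s / \<rho> ^ j)" for j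
    unfolding truncated_moment_def by (rule integral_mult_right_zero)
  ultimately show ?thesis by (simp only: Bochner_Integration.integral_zero)
qed

text \<open>
  This replaces Karamata's theorem on regularly varying tails. At the scale \<open>\<rho> ^ i * b n\<close>, which
  is at least \<open>b (2 ^ i * n)\<close>, the truncated second moment is at most \<open>C / (2 ^ i * n)\<close>, while
  the recursion multiplies it by \<open>\<rho> ^ i\<close>. The resulting geometric series converges because
  \<open>\<rho> < 2\<close>. Applying the bound with \<open>2 ^ k * n\<close> in place of \<open>n\<close> gives the decay in \<open>k\<close>.
\<close>

lemma truncated_moment_bound:
  assumes int: "integrable M (\<lambda>y. y)" and b: "\<And>n::nat. b n > 0" and \<rho>: "1 < \<rho>" "\<rho> < 2"
    and K: "\<forall>\<^sub>F n in sequentially. real n * (LINT y|M. min ((y / b n)\<^sup>2) 1) \<le> C"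
    and growth: "\<forall>\<^sub>F n in sequentially. b (2 * n) \<le> \<rho> * b n"
  shows "\<exists>C'. \<forall>\<^sub>F n in sequentially. \<forall>k. real n * truncated_moment M (1 / (\<rho> ^ k * b n)) \<le> C' / 2 ^ k"
proof -
  obtain N where N: "\<And>n. n \<ge> N \<Longrightarrow> real n * (LINT y|M. min ((y / b n)\<^sup>2) 1) \<le> C"
      "\<And>n. n \<ge> N \<Longrightarrow> b (2 * n) \<le> \<rho> * b n" 
    using eventually_conj[OF K growth] by (auto simp: eventually_sequentially)
  have le_pow: "N \<le> 2 ^ k * n" if "N \<le> n" for n k
  proof -
    have "1 * n \<le> 2 ^ k * n" by (rule mult_le_mono1) simp
    with that show ?thesis by linarith
  qed
  have iter: "b (2 ^ k * n) \<le> \<rho> ^ k * b n" if n: "n \<ge> N" for n k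
  proof (induction k)
    case (Suc k)
    have "N \<le> 2 ^ k * n" using n by (rule le_pow)
    then have "b (2 * (2 ^ k * n)) \<le> \<rho> * b (2 ^ k * n)" by (rule N(2))
    also have "\<dots> \<le> \<rho> * (\<rho> ^ k * b n)" using Suc \<rho> by (intro mult_left_mono) auto
    finally show ?case by (simp add: mult.assoc)
  qed simp
  have "0 \<le> real N * (LINT y|M. min ((y / b N)\<^sup>2) 1)"
    by (intro mult_nonneg_nonneg Bochner_Integration.integral_nonneg) auto
  then have "C \<ge> 0" by (rule order_trans) (rule N(1), simp)
  define C' where "C' = \<rho> * C / (1 - \<rho> / 2)"
  have le: "real n * truncated_moment M (1 / b n) \<le> C'" if n: "n \<ge> N" "n > 0" for n
  proof (rule LIMSEQ_le_const)
    have "(\<lambda>j. real n * (\<rho> ^ j * truncated_moment M (1 / b n / \<rho> ^ j)) + C') \<longlonglongrightarrow> real n * 0 + C'"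
      using b[of n] \<rho> by (intro tendsto_intros truncated_moment_vanishes int) auto
    then show "(\<lambda>j. real n * (\<rho> ^ j * truncated_moment M (1 / b n / \<rho> ^ j)) + C') \<longlonglongrightarrow> C'" by simp
    have "real n * truncated_moment M (1 / b n) \<le> real n * (\<rho> ^ j * truncated_moment M (1 / b n / \<rho> ^ j)) + C'" for j
    proof -
      have summand: "real n * (\<rho> * \<rho> ^ i * (LINT y|M. min ((1 / b n / \<rho> ^ i * y)\<^sup>2) 1)) \<le> \<rho> * C * (\<rho> / 2) ^ i" for i
      proof -
        have "(LINT y|M. min ((1 / b n / \<rho> ^ i * y)\<^sup>2) 1) \<le> (LINT y|M. min ((y / b (2 ^ i * n))\<^sup>2) 1)"
        proof (rule integral_mono)
          show "min ((1 / b n / \<rho> ^ i * y)\<^sup>2) 1 \<le> min ((y / b (2 ^ i * n))\<^sup>2) 1" for y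
          proof -
            have "\<bar>1 / b n / \<rho> ^ i * y\<bar> = \<bar>y\<bar> / (\<rho> ^ i * b n)"
              using b[of n] \<rho> by (simp add: abs_mult abs_divide)
            also have "\<dots> \<le> \<bar>y\<bar> / b (2 ^ i * n)"
              using iter[OF n(1), of i] b[of n] b[of "2 ^ i * n"] \<rho> by (intro divide_left_mono) auto
            also have "\<dots> = \<bar>y / b (2 ^ i * n)\<bar>" using b[of "2 ^ i * n"] by simp
            finally have "\<bar>1 / b n / \<rho> ^ i * y\<bar> \<le> \<bar>y / b (2 ^ i * n)\<bar>" .
            then have "(1 / b n / \<rho> ^ i * y)\<^sup>2 \<le> (y / b (2 ^ i * n))\<^sup>2" by (simp only: abs_le_square_iff)
            then show ?thesis by auto
          qed
        qed (auto intro!: integrable_const_bound[where B = 1])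
        then have "real (2 ^ i * n) * (LINT y|M. min ((1 / b n / \<rho> ^ i * y)\<^sup>2) 1)
            \<le> real (2 ^ i * n) * (LINT y|M. min ((y / b (2 ^ i * n))\<^sup>2) 1)"
          by (intro mult_left_mono) auto
        also have "\<dots> \<le> C"
          using n by (intro N(1) le_pow)
        finally have "\<rho> * (\<rho> / 2) ^ i * (real (2 ^ i * n) * (LINT y|M. min ((1 / b n / \<rho> ^ i * y)\<^sup>2) 1))
            \<le> \<rho> * (\<rho> / 2) ^ i * C"
          using \<rho> by (intro mult_left_mono) auto
        then show ?thesis by (simp add: power_divide field_simps)
      qed
      have "real n * (\<Sum>i<j. \<rho> * \<rho> ^ i * (LINT y|M. min ((1 / b n / \<rho> ^ i * y)\<^sup>2) 1)) \<le> (\<Sum>i<j. \<rho> * C * (\<rho> / 2) ^ i)"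
        unfolding sum_distrib_left by (intro sum_mono summand)
      also have "\<dots> = \<rho> * C * (\<Sum>i<j. (\<rho> / 2) ^ i)" by (simp add: sum_distrib_left)
      also have "\<dots> \<le> \<rho> * C * (1 / (1 - \<rho> / 2))"
      proof (intro mult_left_mono)
        have "(\<Sum>i<j. (\<rho> / 2) ^ i) = (1 - (\<rho> / 2) ^ j) / (1 - \<rho> / 2)"
          using \<rho> by (subst sum_gp_strict) auto
        also have "\<dots> \<le> 1 / (1 - \<rho> / 2)" using \<rho> by (intro divide_right_mono) auto
        finally show "(\<Sum>i<j. (\<rho> / 2) ^ i) \<le> 1 / (1 - \<rho> / 2)" .
      qed (use \<rho> \<open>C \<ge> 0\<close> in auto)
      finally have "real n * (\<Sum>i<j. \<rho> * \<rho> ^ i * (LINT y|M. min ((1 / b n / \<rho> ^ i * y)\<^sup>2) 1)) \<le> C'"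
        by (simp add: C'_def)
      moreover have "real n * truncated_moment M (1 / b n) \<le> real n * (\<rho> ^ j * truncated_moment M (1 / b n / \<rho> ^ j)
          + (\<Sum>i<j. \<rho> * \<rho> ^ i * (LINT y|M. min ((1 / b n / \<rho> ^ i * y)\<^sup>2) 1)))"
        using truncated_moment_recursion[OF int _ \<rho>(1), of "1 / b n" j] b[of n] by (intro mult_left_mono) auto
      ultimately show ?thesis by (simp add: distrib_left)
    qed
    then show "\<exists>N. \<forall>j\<ge>N. real n * truncated_moment M (1 / b n) \<le> real n * (\<rho> ^ j * truncated_moment M (1 / b n / \<rho> ^ j)) + C'"
      by blast
  qed
  have "real n * truncated_moment M (1 / (\<rho> ^ k * b n)) \<le> C' / 2 ^ k" if n: "n \<ge> max N 1" for n k
  proof -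
    have "N \<le> 2 ^ k * n"
      using n by (intro le_pow) simp
    have "truncated_moment M (1 / (\<rho> ^ k * b n)) \<le> truncated_moment M (1 / b (2 ^ k * n))"
      using iter[of n k] b[of n] b[of "2 ^ k * n"] \<rho> n
      by (intro truncated_moment_mono int) (auto intro!: divide_left_mono)
    then have "real (2 ^ k * n) * truncated_moment M (1 / (\<rho> ^ k * b n)) \<le> real (2 ^ k * n) * truncated_moment M (1 / b (2 ^ k * n))"
      by (intro mult_left_mono) auto
    also have "\<dots> \<le> C'" using \<open>N \<le> 2 ^ k * n\<close> n by (intro le) auto
    finally show ?thesis by (simp add: field_simps)
  qed
  then show ?thesis unfolding eventually_sequentially by blast
qed

end

section \<open>Sums of independent copies of a nonnegative variable with mean one\<close>

abbreviation iid :: "real measure \<Rightarrow> (nat \<Rightarrow> real) measure" where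
  "iid M \<equiv> PiM UNIV (\<lambda>_::nat. M)"

context real_distribution
begin

lemma prob_space_iid: "prob_space (iid M)"
  by (rule prob_space_PiM) (rule prob_space_axioms)

lemma distr_coordinate: "distr (iid M) borel (\<lambda>y. y i) = M"
proof -
  have "distr (iid M) borel (\<lambda>y. y i) = distr (iid M) M (\<lambda>y. y i)"
    by (rule distr_cong) auto
  then show ?thesis using distr_PiM_component[of UNIV "\<lambda>_. M" i] prob_space_axioms by simp
qed

lemma coordinate_measurable: "(\<lambda>y. y i) \<in> borel_measurable (iid M)"
proof -
  have "(\<lambda>y. y i) \<in> measurable (iid M) M" by measurable
  then show ?thesis by simp
qed

context
  notes [measurable] = coordinate_measurable
begin

lemma indep_coordinates: "prob_space.indep_vars (iid M) (\<lambda>_. borel) (\<lambda>i y. y i) UNIV"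
proof -
  interpret Q: prob_space "iid M" by (rule prob_space_iid)
  have sets: "sets (PiM UNIV (\<lambda>_::nat. borel :: real measure)) = sets (iid M)"
    by (intro sets_PiM_cong) auto
  show ?thesis
  proof (subst Q.indep_vars_iff_distr_eq_PiM)
    have "distr (iid M) (PiM UNIV (\<lambda>_. borel)) (\<lambda>x. \<lambda>i\<in>UNIV. x i) = distr (iid M) (iid M) (\<lambda>x. x)"
      by (rule distr_cong) (auto simp: sets)
    then show "distr (iid M) (PiM UNIV (\<lambda>_. borel)) (\<lambda>x. \<lambda>i\<in>UNIV. x i)
        = PiM UNIV (\<lambda>i. distr (iid M) borel (\<lambda>y. y i))"
      by (simp add: distr_coordinate distr_id)
  qed auto
qed

lemma integral_coordinate:
  fixes f :: "real \<Rightarrow> 'b::{banach, second_countable_topology}"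
  assumes [measurable]: "f \<in> borel_measurable borel"
  shows "(LINT y|iid M. f (y i)) = (LINT x|M. f x)"
  by (subst (2) distr_coordinate[symmetric, of i], subst integral_distr) auto

lemma integrable_coordinate:
  fixes f :: "real \<Rightarrow> 'b::{banach, second_countable_topology}"
  assumes [measurable]: "f \<in> borel_measurable borel"
  shows "integrable (iid M) (\<lambda>y. f (y i)) \<longleftrightarrow> integrable M f"
  by (subst (2) distr_coordinate[symmetric, of i], subst integrable_distr_eq) auto

definition sum_law :: "(nat \<Rightarrow> real) \<Rightarrow> (nat \<Rightarrow> real) \<Rightarrow> nat \<Rightarrow> real measure" where
  "sum_law b a n = distr (iid M) borel (\<lambda>y. (\<Sum>i<n. y i) / b n - a n)"

lemma real_distribution_sum_law: "real_distribution (sum_law b a n)"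
proof -
  interpret Q: prob_space "iid M" by (rule prob_space_iid)
  show ?thesis unfolding sum_law_def by (rule Q.real_distribution_distr) measurable
qed

lemma char_sum_law: "char (sum_law b a n) t = iexp (- (t * a n)) * char M (t / b n) ^ n"
proof -
  interpret Q: prob_space "iid M" by (rule prob_space_iid)
  have "char (distr (iid M) borel (\<lambda>y. \<Sum>i<n. y i)) (t / b n) = char M (t / b n) ^ n"
    by (subst Q.char_distr_sum[OF Q.indep_vars_subset[OF indep_coordinates]])
       (auto simp: distr_coordinate)
  moreover have "char (sum_law b a n) t = (CLINT y|iid M. iexp (t * ((\<Sum>i<n. y i) / b n - a n)))"
    unfolding sum_law_def char_def by (subst integral_distr) auto
  moreover have "\<dots> = (CLINT y|iid M. iexp (- (t * a n)) * iexp (t / b n * (\<Sum>i<n. y i)))"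
    by (intro Bochner_Integration.integral_cong) (auto simp: algebra_simps simp flip: exp_add)
  moreover have "\<dots> = iexp (- (t * a n)) * char (distr (iid M) borel (\<lambda>y. \<Sum>i<n. y i)) (t / b n)"
    unfolding char_def by (subst integral_distr) auto
  ultimately show ?thesis by simp
qed

lemma norm_char_sum_law: "norm (char (sum_law b a n) t) = norm (char M (t / b n)) ^ n"
  unfolding char_sum_law by (simp add: norm_mult norm_power)

end
end

lemma exp_minus_le: "exp (- x) \<le> 1 - x + min (x\<^sup>2) \<bar>x\<bar>" if "x \<ge> 0" for x :: real
proof -
  have "1 \<le> (1 + x) * (1 - x + x\<^sup>2)"
    using that by (simp add: algebra_simps power2_eq_square)
  also have "\<dots> \<le> exp x * (1 - x + x\<^sup>2)"
  proof (rule mult_right_mono)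
    show "0 \<le> 1 - x + x\<^sup>2"
      using zero_le_power2[of "x - 1"] that by (simp add: power2_eq_square algebra_simps) 
  qed simp
  finally have "exp (- x) \<le> 1 - x + x\<^sup>2" by (simp add: exp_minus field_simps)
  then show ?thesis using that by (auto simp: min_def)
qed

locale mean_one_distribution = real_distribution +
  assumes nonneg: "AE y in M. 0 \<le> y"
    and integrable_id: "integrable M (\<lambda>y. y)"
    and mean_one: "(LINT y|M. y) = 1"
begin

lemma integrable_exp_neg: "s \<ge> 0 \<Longrightarrow> integrable M (\<lambda>y. exp (- s * y))"
  using nonneg by (intro integrable_const_bound[where B = 1]) auto

text \<open>
  The mean being 1, the linear term of the expansion of \<open>exp (- s y)\<close> cancels against the
  centring.
\<close>

lemma exp_moment_le: "(LINT y|M. exp (- s * (y - 1))) \<le> exp (truncated_moment M s)" if s: "s \<ge> 0"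
proof -
  have "(LINT y|M. exp (- s * y)) \<le> (LINT y|M. 1 - s * y + min ((s * y)\<^sup>2) (s * \<bar>y\<bar>))"
  proof (rule integral_mono_AE)
    show "AE y in M. exp (- s * y) \<le> 1 - s * y + min ((s * y)\<^sup>2) (s * \<bar>y\<bar>)"
      using nonneg
    proof eventually_elim
      case (elim y)
      then show ?case using exp_minus_le[of "s * y"] s by simp
    qed
    show "integrable M (\<lambda>y. 1 - s * y + min ((s * y)\<^sup>2) (s * \<bar>y\<bar>))"
      using integrable_id integrable_truncated[OF integrable_id s] by simp
  qed (rule integrable_exp_neg[OF s])
  also have "\<dots> = (LINT y|M. 1 - s * y) + truncated_moment M s"
    unfolding truncated_moment_def
    using integrable_id integrable_truncated[OF integrable_id s]
    by (intro Bochner_Integration.integral_add) auto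
  also have "(LINT y|M. 1 - s * y) = 1 - s"
    using integrable_id prob_space by (subst Bochner_Integration.integral_diff) (auto simp: mean_one)
  also have "1 - s + truncated_moment M s \<le> exp (- s + truncated_moment M s)"
    by (rule order_trans[OF _ exp_ge_add_one_self]) simp
  finally have "exp s * (LINT y|M. exp (- s * y)) \<le> exp s * exp (- s + truncated_moment M s)"
    by (intro mult_left_mono) auto
  moreover have "exp s * (LINT y|M. exp (- s * y)) = (LINT y|M. exp (- s * (y - 1)))"
  proof -
    have "exp (- s * (y - 1)) = exp s * exp (- s * y)" for y
      by (simp add: algebra_simps flip: exp_add)
    then show ?thesis by (simp only: integral_mult_right_zero)
  qed
  ultimately show ?thesis by (simp flip: exp_add)
qed

context
  notes [measurable] = coordinate_measurable
begin

definition centred_law :: "(nat \<Rightarrow> real) \<Rightarrow> nat \<Rightarrow> real measure" where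
  "centred_law b = sum_law b (\<lambda>n. real n / b n)"

lemma
  fixes b :: "nat \<Rightarrow> real"
  assumes s: "s \<ge> 0" and b: "b n > 0"
  shows integrable_exp_centred_law: "integrable (centred_law b n) (\<lambda>z. exp (- s * z))"
    and exp_moment_centred_law_le:
      "(LINT z|centred_law b n. exp (- s * z)) \<le> exp (real n * truncated_moment M (s / b n))"
proof -
  interpret Q: prob_space "iid M" by (rule prob_space_iid)
  let ?g = "\<lambda>x::real. exp (- (s / b n) * (x - 1))"
  have prod: "exp (- s * ((\<Sum>i<n. y i) / b n - real n / b n)) = (\<Prod>i<n. ?g (y i))" for y
  proof -
    have "- s * ((\<Sum>i<n. y i) / b n - real n / b n) = (\<Sum>i<n. - (s / b n) * (y i - 1))"
      using b by (simp add: sum_subtractf field_simps sum_negf flip: sum_distrib_left sum_divide_distrib)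
    then show ?thesis by (simp add: exp_sum)
  qed
  have g: "integrable M ?g"
  proof -
    have "integrable M (\<lambda>y. exp (s / b n) * exp (- (s / b n) * y))"
      using s b by (intro integrable_mult_right integrable_exp_neg) simp
    moreover have "?g y = exp (s / b n) * exp (- (s / b n) * y)" for y
      by (simp add: algebra_simps diff_divide_distrib flip: exp_add)
    ultimately show ?thesis by (simp only:)
  qed
  have ind: "Q.indep_vars (\<lambda>_. borel) (\<lambda>i y. ?g (y i)) {..<n}"
    by (rule Q.indep_vars_compose2[OF Q.indep_vars_subset[OF indep_coordinates]]) auto
  have gi: "integrable (iid M) (\<lambda>y. ?g (y i))" for i
    using g by (subst integrable_coordinate) auto
  have "integrable (iid M) (\<lambda>y. exp (- s * ((\<Sum>i<n. y i) / b n - real n / b n)))"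
    unfolding prod by (rule Q.indep_vars_integrable[OF _ ind gi]) simp
  then show "integrable (centred_law b n) (\<lambda>z. exp (- s * z))"
    unfolding centred_law_def sum_law_def by (subst integrable_distr_eq) simp_all
  have "(LINT z|centred_law b n. exp (- s * z)) = (LINT y|iid M. (\<Prod>i<n. ?g (y i)))"
    unfolding centred_law_def sum_law_def prod[symmetric] by (subst integral_distr) auto
  also have "\<dots> = (\<Prod>i<n. LINT y|iid M. ?g (y i))"
    by (rule Q.indep_vars_lebesgue_integral[OF _ ind gi]) simp
  also have "\<dots> = (LINT x|M. ?g x) ^ n"
    by (subst integral_coordinate) auto
  also have "\<dots> \<le> exp (truncated_moment M (s / b n)) ^ n"
    using s b by (intro power_mono exp_moment_le Bochner_Integration.integral_nonneg) auto
  also have "\<dots> = exp (real n * truncated_moment M (s / b n))"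
    by (simp flip: exp_of_nat_mult)
  finally show "(LINT z|centred_law b n. exp (- s * z)) \<le> exp (real n * truncated_moment M (s / b n))" .
qed

lemma
  shows integrable_centred_law: "integrable (centred_law b n) (\<lambda>z. z)"
    and mean_centred_law: "(LINT z|centred_law b n. z) = 0"
proof -
  interpret Q: prob_space "iid M" by (rule prob_space_iid)
  have i1: "integrable (iid M) (\<lambda>y. y i)" for i
    by (rule integrable_coordinate[of "\<lambda>x. x", THEN iffD2, OF _ integrable_id]) simp
  have i2: "(LINT y|iid M. y i) = 1" for i
    unfolding mean_one[symmetric] by (rule integral_coordinate[of "\<lambda>x. x"]) simp
  have sum: "integrable (iid M) (\<lambda>y. (\<Sum>i<n. y i) / b n)"
    by (intro integrable_divide Bochner_Integration.integrable_sum i1)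
  then have "integrable (iid M) (\<lambda>y. (\<Sum>i<n. y i) / b n - real n / b n)"
    by (rule Bochner_Integration.integrable_diff) simp
  then show "integrable (centred_law b n) (\<lambda>z. z)"
    unfolding centred_law_def sum_law_def by (subst integrable_distr_eq) simp_all
  have "(LINT z|centred_law b n. z) = (LINT y|iid M. (\<Sum>i<n. y i) / b n - real n / b n)"
    unfolding centred_law_def sum_law_def by (subst integral_distr) simp_all
  also have "\<dots> = (LINT y|iid M. (\<Sum>i<n. y i) / b n) - real n / b n"
    using Q.prob_space by (subst Bochner_Integration.integral_diff[OF sum]) simp_all
  also have "(LINT y|iid M. (\<Sum>i<n. y i) / b n) = (\<Sum>i<n. LINT y|iid M. y i) / b n"
    by (subst integral_divide_zero, subst Bochner_Integration.integral_sum) (simp_all add: i1)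
  finally show "(LINT z|centred_law b n. z) = 0" by (simp add: i2)
qed

lemma real_distribution_centred_law: "real_distribution (centred_law b n)"
  unfolding centred_law_def by (rule real_distribution_sum_law)

text \<open>
  Jensen's inequality at the mean 0.
\<close>

lemma exp_moment_centred_law_ge:
  assumes "s \<ge> 0" and "b n > 0"
  shows "1 \<le> (LINT z|centred_law b n. exp (- s * z))"
proof -
  interpret Z: real_distribution "centred_law b n" by (rule real_distribution_centred_law)
  have "(LINT z|centred_law b n. 1 - s * z) \<le> (LINT z|centred_law b n. exp (- s * z))"
  proof (rule integral_mono)
    show "1 - s * z \<le> exp (- s * z)" for z using exp_ge_add_one_self[of "- s * z"] by simp
  qed (use integrable_centred_law integrable_exp_centred_law assms in auto)
  moreover have "(LINT z|centred_law b n. 1 - s * z) = 1"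
    using integrable_centred_law Z.prob_space
    by (subst Bochner_Integration.integral_diff) (auto simp: mean_centred_law)
  ultimately show ?thesis by simp
qed

text \<open>
  As the mean is 0, positive and negative parts have equal expectation, and the exponential
  moment controls the negative part.
\<close>

lemma abs_moment_centred_law_le:
  assumes "b n > 0"
  shows "(LINT z|centred_law b n. \<bar>z\<bar>) \<le> 2 * (LINT z|centred_law b n. exp (- 1 * z))"
proof -
  have int: "integrable (centred_law b n) (\<lambda>z. exp (- 1 * z))"
    using assms by (intro integrable_exp_centred_law) auto
  have "(LINT z|centred_law b n. \<bar>z\<bar>) \<le> (LINT z|centred_law b n. z + 2 * exp (- 1 * z))"
  proof (rule integral_mono)
    show "\<bar>z\<bar> \<le> z + 2 * exp (- 1 * z)" for z :: real
    proof (cases "z \<ge> 0")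
      case False
      then show ?thesis using exp_ge_add_one_self[of "- 1 * z"] by (simp add: abs_if)
    qed simp
  qed (use integrable_centred_law int in \<open>auto simp del: mult_minus1\<close>)
  also have "\<dots> = 2 * (LINT z|centred_law b n. exp (- 1 * z))"
    using integrable_centred_law int
    by (subst Bochner_Integration.integral_add) (auto simp: mean_centred_law simp del: mult_minus1)
  finally show ?thesis .
qed

end
end

section \<open>Exponential moments under weak convergence\<close>

lemma (in real_distribution) integrable_if_truncations_bounded:
  fixes f :: "real \<Rightarrow> real"
  assumes f [measurable]: "f \<in> borel_measurable borel" and nonneg: "\<And>x. 0 \<le> f x"
    and bd: "\<And>K::nat. (LINT x|M. min (f x) (real K)) \<le> C"
  shows "integrable M f"
proof -
  let ?f = "\<lambda>K::nat. \<lambda>x. min (f x) (real K)"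
  have int: "integrable M (?f K)" for K
    using nonneg by (intro integrable_const_bound[where B = "real K"]) (auto simp: min_def)
  have "incseq (\<lambda>K. LINT x|M. ?f K x)"
    unfolding incseq_def
    by (intro allI impI integral_mono int min.mono order_refl) simp
  then obtain l where l: "(\<lambda>K. LINT x|M. ?f K x) \<longlonglongrightarrow> l"
    using incseq_convergent bd by metis
  show ?thesis
  proof (rule integrable_monotone_convergence[OF int _ _ l])
    show "AE x in M. mono (\<lambda>K. ?f K x)" by (auto simp: mono_def min_def)
    show "AE x in M. (\<lambda>K. ?f K x) \<longlonglongrightarrow> f x"
    proof (rule AE_I2)
      fix x
      obtain N where "f x \<le> real N" using real_arch_simple by blast
      then have "\<forall>\<^sub>F K in sequentially. ?f K x = f x"
        unfolding eventually_sequentially by (intro exI[of _ N]) (auto simp: min_def)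
      then show "(\<lambda>K. ?f K x) \<longlonglongrightarrow> f x" by (rule tendsto_eventually)
    qed
  qed simp
qed

text \<open>
  Fatou's lemma for weak convergence, through truncations of \<open>f\<close>.
\<close>

lemma weak_conv_integrable:
  fixes f :: "real \<Rightarrow> real"
  assumes Mn: "\<And>n. real_distribution (Mn n)" and L: "real_distribution L" and weak: "weak_conv_m Mn L"
    and cont: "\<And>x. isCont f x" and nonneg: "\<And>x. 0 \<le> f x"
    and int: "\<And>n. integrable (Mn n) f"
    and bd: "\<forall>\<^sub>F n in sequentially. (LINT x|Mn n. f x) \<le> C"
  shows "integrable L f"
proof -
  interpret L: real_distribution L by fact
  have meas: "f \<in> borel_measurable borel"
    using cont by (intro borel_measurable_continuous_onI continuous_at_imp_continuous_on) auto
  show ?thesis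
  proof (rule L.integrable_if_truncations_bounded[OF meas nonneg])
    fix K :: nat
    show "(LINT x|L. min (f x) (real K)) \<le> C"
    proof (rule tendsto_upperbound)
      show "(\<lambda>n. LINT x|Mn n. min (f x) (real K)) \<longlonglongrightarrow> (LINT x|L. min (f x) (real K))"
        using nonneg cont
        by (intro weak_conv_imp_integral_bdd_continuous_conv[OF Mn L weak, where B = "real K"] continuous_intros)
           (auto simp: min_def)
      show "\<forall>\<^sub>F n in sequentially. (LINT x|Mn n. min (f x) (real K)) \<le> C"
        using bd
      proof eventually_elim
        case (elim n)
        interpret Mn: real_distribution "Mn n" by (rule Mn)
        have "(LINT x|Mn n. min (f x) (real K)) \<le> (LINT x|Mn n. f x)"
        proof (rule integral_mono[OF _ int])
          show "integrable (Mn n) (\<lambda>x. min (f x) (real K))"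
            using meas nonneg by (intro Mn.integrable_const_bound[where B = "real K"]) (auto simp: min_def)
        qed simp
        with elim show ?case by simp
      qed
    qed simp
  qed
qed

text \<open>
  The exponential moment at \<open>2 s\<close> serves as the square that makes the family at \<open>s\<close> uniformly
  integrable.
\<close>

lemma (in real_distribution) exp_moment_truncation:
  assumes int: "integrable M (\<lambda>x. exp (- s * x))" "integrable M (\<lambda>x. exp (- (2 * s) * x))"
    and K: "K > 0"
  shows "\<bar>(LINT x|M. exp (- s * x)) - (LINT x|M. min (exp (- s * x)) K)\<bar>
    \<le> (LINT x|M. exp (- (2 * s) * x)) / K"
proof -
  have trunc: "integrable M (\<lambda>x. min (exp (- s * x)) K)"
    using K by (intro integrable_const_bound[where B = K]) (auto simp: min_def)
  have "(LINT x|M. exp (- s * x)) - (LINT x|M. min (exp (- s * x)) K)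
      = (LINT x|M. exp (- s * x) - min (exp (- s * x)) K)"
    using int trunc by (subst Bochner_Integration.integral_diff) auto
  also have "\<bar>\<dots>\<bar> \<le> (LINT x|M. \<bar>exp (- s * x) - min (exp (- s * x)) K\<bar>)"
    using integral_norm_bound[of M "\<lambda>x. exp (- s * x) - min (exp (- s * x)) K"] by simp
  also have "\<dots> \<le> (LINT x|M. exp (- (2 * s) * x) / K)"
  proof (rule integral_mono)
    show "integrable M (\<lambda>x. \<bar>exp (- s * x) - min (exp (- s * x)) K\<bar>)"
      using int trunc by (intro integrable_abs Bochner_Integration.integrable_diff)
    show "\<bar>exp (- s * x) - min (exp (- s * x)) K\<bar> \<le> exp (- (2 * s) * x) / K" for x
    proof -
      have sq: "exp (- (2 * s) * x) = exp (- s * x) * exp (- s * x)"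
        by (simp add: algebra_simps flip: exp_add)
      have "K * \<bar>e - min e K\<bar> \<le> e * e" if "e > 0" for e
      proof (cases "e \<le> K")
        case False
        then have "K * (e - K) \<le> e * e" using K that by (intro mult_mono) auto
        then show ?thesis using False by simp
      qed simp
      from this[of "exp (- s * x)"] show ?thesis unfolding sq using K by (simp add: field_simps)
    qed
  qed (use int in simp)
  also have "\<dots> = (LINT x|M. exp (- (2 * s) * x)) / K" by simp
  finally show ?thesis .
qed

lemma weak_conv_exp_moments:
  fixes C :: "real \<Rightarrow> real"
  assumes Mn: "\<And>n. real_distribution (Mn n)" and L: "real_distribution L" and weak: "weak_conv_m Mn L"
    and int: "\<And>n s. s \<ge> 0 \<Longrightarrow> integrable (Mn n) (\<lambda>x. exp (- s * x))"
    and bd: "\<And>s. s \<ge> 0 \<Longrightarrow> \<forall>\<^sub>F n in sequentially. (LINT x|Mn n. exp (- s * x)) \<le> C s"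
    and s: "s \<ge> 0"
  shows "integrable L (\<lambda>x. exp (- s * x))"
    and "(\<lambda>n. LINT x|Mn n. exp (- s * x)) \<longlonglongrightarrow> (LINT x|L. exp (- s * x))"
proof -
  have intL: "integrable L (\<lambda>x. exp (- s * x))" if "s \<ge> 0" for s
    by (rule weak_conv_integrable[OF Mn L weak _ _ int[OF that] bd[OF that]]) (auto intro!: continuous_intros)
  from intL[OF s] show "integrable L (\<lambda>x. exp (- s * x))" .
  define D where "D = \<bar>C (2 * s)\<bar> + (LINT x|L. exp (- (2 * s) * x)) + 1"
  have "(LINT x|L. exp (- (2 * s) * x)) \<ge> 0" by (rule Bochner_Integration.integral_nonneg) simp
  then have D: "D > 0" "C (2 * s) \<le> D" "(LINT x|L. exp (- (2 * s) * x)) \<le> D" unfolding D_def by linarith+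
  show "(\<lambda>n. LINT x|Mn n. exp (- s * x)) \<longlonglongrightarrow> (LINT x|L. exp (- s * x))"
  proof (rule tendstoI)
    fix e :: real assume e: "e > 0"
    define K where "K = 3 * D / e"
    have K: "K > 0" "D / K = e / 3" using e D by (auto simp: K_def)
    have "(\<lambda>n. LINT x|Mn n. min (exp (- s * x)) K) \<longlonglongrightarrow> (LINT x|L. min (exp (- s * x)) K)"
      using K by (intro weak_conv_imp_integral_bdd_continuous_conv[OF Mn L weak, where B = K] continuous_intros)
        (auto simp: min_def)
    then have "\<forall>\<^sub>F n in sequentially. dist (LINT x|Mn n. min (exp (- s * x)) K) (LINT x|L. min (exp (- s * x)) K) < e / 3"
      using e by (intro tendstoD) auto
    moreover have "\<forall>\<^sub>F n in sequentially. (LINT x|Mn n. exp (- (2 * s) * x)) \<le> C (2 * s)"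
      using s by (intro bd) simp
    ultimately show "\<forall>\<^sub>F n in sequentially. dist (LINT x|Mn n. exp (- s * x)) (LINT x|L. exp (- s * x)) < e"
    proof eventually_elim
      case (elim n)
      have le: "q / K \<le> e / 3" if "q \<le> D" for q
        using divide_right_mono[OF that, of K] K by linarith
      have "\<bar>(LINT x|Mn n. exp (- s * x)) - (LINT x|Mn n. min (exp (- s * x)) K)\<bar> \<le> (LINT x|Mn n. exp (- (2 * s) * x)) / K"
        using s by (intro real_distribution.exp_moment_truncation[OF Mn] int K) auto
      also have "\<dots> \<le> e / 3" using elim(2) D by (intro le) simp
      finally have 1: "\<bar>(LINT x|Mn n. exp (- s * x)) - (LINT x|Mn n. min (exp (- s * x)) K)\<bar> \<le> e / 3" .
      have "\<bar>(LINT x|L. exp (- s * x)) - (LINT x|L. min (exp (- s * x)) K)\<bar> \<le> (LINT x|L. exp (- (2 * s) * x)) / K"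
        using s by (intro real_distribution.exp_moment_truncation[OF L] intL K) auto
      also have "\<dots> \<le> e / 3" using D by (intro le) simp
      finally show ?case using 1 elim(1) unfolding dist_real_def by linarith
    qed
  qed
qed

section \<open>Stable laws and their exponents\<close>

lemma additive_nonneg_linear:
  fixes G :: "real \<Rightarrow> real"
  assumes add: "\<And>u v. u > 0 \<Longrightarrow> v > 0 \<Longrightarrow> G (u + v) = G u + G v"
    and nonneg: "\<And>u. u > 0 \<Longrightarrow> G u \<ge> 0" and u: "u > 0"
  shows "G u = u * G 1"
proof -
  have mult: "G (real (Suc n) * v) = real (Suc n) * G v" if "v > 0" for n v
  proof (induction n)
    case (Suc n)
    have "G (real (Suc n) * v + v) = G (real (Suc n) * v) + G v" using that by (intro add) auto
    then show ?case using Suc by (simp add: algebra_simps)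
  qed simp
  have mono: "G v \<le> G w" if "0 < v" "v < w" for v w
    using add[of v "w - v"] nonneg[of "w - v"] that by simp
  have close: "\<bar>real (Suc n) * (G u - u * G 1)\<bar> \<le> G 1" for n
  proof -
    define m where "m = nat \<lfloor>real (Suc n) * u\<rfloor>"
    have m: "real m \<le> real (Suc n) * u" "real (Suc n) * u < real m + 1"
      using u unfolding m_def by (auto simp: floor_le_iff)
    have "G (real (Suc n) * u) \<le> G (real m + 1)"
      using m(2) u by (intro mono) auto
    also have "G (real m + 1) = (real m + 1) * G 1" using mult[of 1 m] by (simp add: add.commute)
    finally have up: "real (Suc n) * G u \<le> real m * G 1 + G 1" using mult[OF u] by (simp add: algebra_simps)
    have lo: "real m * G 1 \<le> real (Suc n) * G u"
    proof (cases m)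
      case 0
      then show ?thesis using nonneg[OF u] by simp
    next
      case (Suc k)
      have "G (real m) \<le> G (real (Suc n) * u)"
        using m(1) Suc mono[of "real m" "real (Suc n) * u"] by (cases "real m = real (Suc n) * u") auto
      then show ?thesis using mult[OF u, of n] mult[of 1 k] Suc by simp
    qed
    have "real m * G 1 \<le> real (Suc n) * u * G 1" "real (Suc n) * u * G 1 \<le> (real m + 1) * G 1"
      using m nonneg[of 1] by (auto intro!: mult_right_mono simp del: of_nat_Suc)
    then show ?thesis using up lo by (simp add: algebra_simps abs_le_iff)
  qed
  have "G u - u * G 1 = 0"
  proof (rule ccontr)
    assume ne: "G u - u * G 1 \<noteq> 0"
    obtain n where "G 1 / \<bar>G u - u * G 1\<bar> < real n" using reals_Archimedean2 by blast
    then have "G 1 < real (Suc n) * \<bar>G u - u * G 1\<bar>" using ne by (simp add: field_simps)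
    then show False using close[of n] by (simp add: abs_mult)
  qed
  then show ?thesis by simp
qed

text \<open>
  Multiplying the functional equation by \<open>\<rho> ^ k\<close> at \<open>s = 1 / \<rho> ^ k\<close> isolates the drift \<open>d\<close>,
  which therefore vanishes. In the variable \<open>u = s powr \<alpha>\<close> the remaining equation is Cauchy's.
\<close>

lemma stable_exponent_is_power:
  fixes \<psi> :: "real \<Rightarrow> real"
  assumes nonneg: "\<And>s. s \<ge> 0 \<Longrightarrow> \<psi> s \<ge> 0"
    and eq: "\<And>a b. a > 0 \<Longrightarrow> b > 0 \<Longrightarrow>
      \<exists>d. \<forall>s\<ge>0. \<psi> (a * s) + \<psi> (b * s) = \<psi> ((a powr \<alpha> + b powr \<alpha>) powr (1 / \<alpha>) * s) + d * s"
    and vanish: "\<And>a. a > 0 \<Longrightarrow> (\<lambda>k. \<rho> ^ k * \<psi> (a / \<rho> ^ k)) \<longlonglongrightarrow> 0"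
    and \<rho>: "\<rho> > 0" and \<alpha>: "\<alpha> > 0" and s: "s > 0"
  shows "\<psi> s = \<psi> 1 * s powr \<alpha>"
proof -
  have eq0: "\<psi> a + \<psi> b = \<psi> ((a powr \<alpha> + b powr \<alpha>) powr (1 / \<alpha>))" if ab: "a > 0" "b > 0" for a b
  proof -
    define c where "c = (a powr \<alpha> + b powr \<alpha>) powr (1 / \<alpha>)"
    have c: "c > 0" using add_pos_pos[of "a powr \<alpha>" "b powr \<alpha>"] ab by (simp add: c_def)
    obtain d where d: "\<And>s. s \<ge> 0 \<Longrightarrow> \<psi> (a * s) + \<psi> (b * s) = \<psi> (c * s) + d * s"
      using eq[OF ab] unfolding c_def by blast
    have "\<rho> ^ k * \<psi> (a / \<rho> ^ k) + \<rho> ^ k * \<psi> (b / \<rho> ^ k) - \<rho> ^ k * \<psi> (c / \<rho> ^ k) = d" for k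
      using d[of "1 / \<rho> ^ k"] \<rho> by (simp add: field_simps)
    moreover have "(\<lambda>k. \<rho> ^ k * \<psi> (a / \<rho> ^ k) + \<rho> ^ k * \<psi> (b / \<rho> ^ k) - \<rho> ^ k * \<psi> (c / \<rho> ^ k)) \<longlonglongrightarrow> 0 + 0 - 0"
      by (intro tendsto_intros vanish ab c)
    ultimately have "d = 0" by (simp add: LIMSEQ_const_iff)
    then show ?thesis using d[of 1] by (simp add: c_def)
  qed
  define G where "G u = \<psi> (u powr (1 / \<alpha>))" for u
  have "G (s powr \<alpha>) = s powr \<alpha> * G 1"
  proof (rule additive_nonneg_linear)
    show "G (u + v) = G u + G v" if "u > 0" "v > 0" for u v
      using eq0[of "u powr (1 / \<alpha>)" "v powr (1 / \<alpha>)"] that \<alpha> by (simp add: G_def powr_powr)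
  qed (use s nonneg in \<open>auto simp: G_def\<close>)
  then show ?thesis using s \<alpha> by (simp add: G_def powr_powr)
qed

lemma nn_exp_moment_convolution:
  assumes M: "real_distribution M" and N: "real_distribution N"
    and intM: "integrable M (\<lambda>x. exp (- s * x))" and intN: "integrable N (\<lambda>x. exp (- s * x))"
  shows "(\<integral>\<^sup>+z. ennreal (exp (- s * z)) \<partial>(M \<star> N)) = ennreal ((LINT x|M. exp (- s * x)) * (LINT x|N. exp (- s * x)))"
proof -
  interpret M: real_distribution M by fact
  interpret N: real_distribution N by fact
  have "(\<integral>\<^sup>+z. ennreal (exp (- s * z)) \<partial>(M \<star> N)) = (\<integral>\<^sup>+x. \<integral>\<^sup>+y. ennreal (exp (- s * (x + y))) \<partial>N \<partial>M)"
    by (rule nn_integral_convolution) (auto intro: M.finite_measure_axioms N.finite_measure_axioms)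
  also have "\<dots> = (\<integral>\<^sup>+x. \<integral>\<^sup>+y. ennreal (exp (- s * x)) * ennreal (exp (- s * y)) \<partial>N \<partial>M)"
  proof (intro nn_integral_cong)
    fix x y
    have "exp (- s * (x + y)) = exp (- s * x) * exp (- s * y)" by (simp add: algebra_simps flip: exp_add)
    then show "ennreal (exp (- s * (x + y))) = ennreal (exp (- s * x)) * ennreal (exp (- s * y))"
      by (simp only: ennreal_mult exp_ge_zero)
  qed
  also have "\<dots> = (\<integral>\<^sup>+x. ennreal (exp (- s * x)) \<partial>M) * (\<integral>\<^sup>+y. ennreal (exp (- s * y)) \<partial>N)"
    by (simp add: nn_integral_cmult nn_integral_multc)
  also have "\<dots> = ennreal ((LINT x|M. exp (- s * x)) * (LINT x|N. exp (- s * x)))"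
    using intM intN by (simp add: nn_integral_eq_integral ennreal_mult Bochner_Integration.integral_nonneg)
  finally show ?thesis .
qed

lemma char_convolution:
  assumes M: "real_distribution M" and N: "real_distribution N"
  shows "char (M \<star> N) t = char M t * char N t"
proof -
  interpret M: real_distribution M by fact
  interpret N: real_distribution N by fact
  interpret P: pair_prob_space M N ..
  have "char (M \<star> N) t = (CLINT p|(M \<Otimes>\<^sub>M N). iexp (t * (fst p + snd p)))"
    unfolding convolution_def char_def by (subst integral_distr) (auto simp: split_beta)
  also have "\<dots> = (CLINT p|(M \<Otimes>\<^sub>M N). (\<lambda>(x, y). iexp (t * x) * iexp (t * y)) p)"
    by (intro Bochner_Integration.integral_cong) (auto simp: exp_add[symmetric] algebra_simps)
  also have "\<dots> = (CLINT x|M. (CLINT y|N. iexp (t * x) * iexp (t * y)))"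
    by (subst P.integral_fst'[symmetric])
       (auto intro!: P.integrable_const_bound[where B = 1] simp: split_beta norm_mult)
  also have "\<dots> = char M t * char N t"
    unfolding char_def by simp
  finally show ?thesis .
qed

context
  fixes \<alpha> :: real and \<mu> :: "real measure"
  assumes stable: "stable_law \<alpha> \<mu>"
begin

lemma stable_real_distribution: "real_distribution \<mu>"
  using stable by (simp add: stable_law_def)

lemma stable_distr_affine: "real_distribution (distr \<mu> borel (\<lambda>z. a * z + d))"
proof -
  interpret real_distribution \<mu> by (rule stable_real_distribution)
  show ?thesis by (rule real_distribution_distr) measurable
qed

lemma stable_obtains:
  assumes "a > 0" "b > 0"
  obtains d where "distr \<mu> borel (\<lambda>z. a * z) \<star> distr \<mu> borel (\<lambda>z. b * z)
    = distr \<mu> borel (\<lambda>z. (a powr \<alpha> + b powr \<alpha>) powr (1 / \<alpha>) * z + d)"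
proof -
  obtain c d where c: "c > 0" "c powr \<alpha> = a powr \<alpha> + b powr \<alpha>"
    and eq: "distr \<mu> borel (\<lambda>z. a * z) \<star> distr \<mu> borel (\<lambda>z. b * z) = distr \<mu> borel (\<lambda>z. c * z + d)"
    using stable assms unfolding stable_law_def by meson
  have "\<alpha> > 0" using stable by (simp add: stable_law_def)
  then have "(a powr \<alpha> + b powr \<alpha>) powr (1 / \<alpha>) = c"
    unfolding c(2)[symmetric] using c(1) by (simp add: powr_powr)
  with eq that show ?thesis by simp
qed

lemma norm_char_stable: "(norm (char \<mu> t))\<^sup>2 = norm (char \<mu> (2 powr (1 / \<alpha>) * t))"
proof -
  interpret real_distribution \<mu> by (rule stable_real_distribution)
  obtain d where eq: "distr \<mu> borel (\<lambda>z. 1 * z) \<star> distr \<mu> borel (\<lambda>z. 1 * z)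
    = distr \<mu> borel (\<lambda>z. (1 powr \<alpha> + 1 powr \<alpha>) powr (1 / \<alpha>) * z + d)"
    by (rule stable_obtains[of 1 1]) auto
  let ?c = "2 powr (1 / \<alpha>)"
  have "distr \<mu> borel (\<lambda>z. 1 * z) = \<mu>"
    using distr_id2[of borel \<mu>] by simp
  then have "char (\<mu> \<star> \<mu>) t = char (distr \<mu> borel (\<lambda>z. ?c * z + d)) t" using eq by simp
  also have "\<dots> = (CLINT z|\<mu>. iexp (t * (?c * z + d)))"
    unfolding char_def by (subst integral_distr) auto
  also have "\<dots> = (CLINT z|\<mu>. iexp (t * d) * iexp (?c * t * z))"
    by (intro Bochner_Integration.integral_cong) (auto simp: exp_add[symmetric] algebra_simps)
  also have "\<dots> = iexp (t * d) * char \<mu> (?c * t)"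
    unfolding char_def by simp
  finally have "norm (char \<mu> t * char \<mu> t) = norm (iexp (t * d) * char \<mu> (?c * t))"
    by (simp add: char_convolution real_distribution_axioms)
  then show ?thesis by (simp add: norm_mult power2_eq_square)
qed

text \<open>
  A translation only changes the drift, so translates of \<open>\<mu>\<close> satisfy the multiplicative
  stability equation with a drift of their own.
\<close>

lemma laplace_stable:
  fixes c0 :: real
  defines "L \<equiv> distr \<mu> borel (\<lambda>z. z + c0)"
  assumes int: "\<And>s. s \<ge> 0 \<Longrightarrow> integrable L (\<lambda>x. exp (- s * x))" and ab: "a > 0" "b > 0"
  shows "\<exists>d. \<forall>s\<ge>0. (LINT x|L. exp (- (a * s) * x)) * (LINT x|L. exp (- (b * s) * x))
     = (LINT x|L. exp (- ((a powr \<alpha> + b powr \<alpha>) powr (1 / \<alpha>) * s) * x)) * exp (d * s)"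
proof -
  interpret real_distribution \<mu> by (rule stable_real_distribution)
  define c where "c = (a powr \<alpha> + b powr \<alpha>) powr (1 / \<alpha>)"
  have c: "c > 0" using add_pos_pos[of "a powr \<alpha>" "b powr \<alpha>"] ab by (simp add: c_def)
  obtain d where eq: "distr \<mu> borel (\<lambda>z. a * z) \<star> distr \<mu> borel (\<lambda>z. b * z) = distr \<mu> borel (\<lambda>z. c * z + d)"
    using stable_obtains[OF ab] unfolding c_def by blast
  let ?m = "\<lambda>s. LINT z|\<mu>. exp (- s * z)"
  have L: "(LINT x|L. exp (- s * x)) = exp (- s * c0) * ?m s" for s
  proof -
    have "(LINT x|L. exp (- s * x)) = (LINT z|\<mu>. exp (- s * (z + c0)))"
      unfolding L_def by (subst integral_distr) auto
    also have "\<dots> = (LINT z|\<mu>. exp (- s * c0) * exp (- s * z))"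
      by (intro Bochner_Integration.integral_cong) (auto simp: exp_add[symmetric] algebra_simps)
    finally show ?thesis by simp
  qed
  have intm: "integrable \<mu> (\<lambda>z. exp (- s * z))" if "s \<ge> 0" for s
  proof -
    have "integrable \<mu> (\<lambda>z. exp (- s * (z + c0)))"
      using int[OF that] unfolding L_def by (subst (asm) integrable_distr_eq) auto
    then have "integrable \<mu> (\<lambda>z. exp (s * c0) * exp (- s * (z + c0)))" by (rule integrable_mult_right)
    moreover have "exp (s * c0) * exp (- s * (z + c0)) = exp (- s * z)" for z
      by (simp add: algebra_simps flip: exp_add)
    ultimately show ?thesis by (simp only:)
  qed
  have m: "?m (a * s) * ?m (b * s) = exp (- s * d) * ?m (c * s)" if s: "s \<ge> 0" for s
  proof -
    have scaled: "(LINT x|distr \<mu> borel (\<lambda>z. e * z). exp (- s * x)) = ?m (e * s)"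
      "integrable (distr \<mu> borel (\<lambda>z. e * z)) (\<lambda>x. exp (- s * x))" if "e > 0" for e
    proof -
      show "(LINT x|distr \<mu> borel (\<lambda>z. e * z). exp (- s * x)) = ?m (e * s)"
        by (subst integral_distr) (auto simp: mult_ac)
      have "integrable \<mu> (\<lambda>z. exp (- (e * s) * z))" using that s by (intro intm) simp
      then show "integrable (distr \<mu> borel (\<lambda>z. e * z)) (\<lambda>x. exp (- s * x))"
        by (subst integrable_distr_eq) (auto simp: mult_ac)
    qed
    have "ennreal (?m (a * s) * ?m (b * s)) =
        (\<integral>\<^sup>+z. ennreal (exp (- s * z)) \<partial>(distr \<mu> borel (\<lambda>z. a * z) \<star> distr \<mu> borel (\<lambda>z. b * z)))"
      using stable_distr_affine[of a 0] stable_distr_affine[of b 0] scaled ab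
      by (subst nn_exp_moment_convolution) auto
    also have "\<dots> = (\<integral>\<^sup>+z. ennreal (exp (- s * (c * z + d))) \<partial>\<mu>)"
      unfolding eq by (subst nn_integral_distr) auto
    also have "\<dots> = (\<integral>\<^sup>+z. ennreal (exp (- s * d) * exp (- (c * s) * z)) \<partial>\<mu>)"
      by (intro nn_integral_cong) (auto simp: exp_add[symmetric] algebra_simps)
    also have "\<dots> = ennreal (LINT z|\<mu>. exp (- s * d) * exp (- (c * s) * z))"
      using c s by (intro nn_integral_eq_integral integrable_mult_right intm) auto
    also have "\<dots> = ennreal (exp (- s * d) * ?m (c * s))" by simp
    finally show ?thesis
      by (subst (asm) ennreal_inj) (auto intro!: mult_nonneg_nonneg Bochner_Integration.integral_nonneg)
  qed
  show ?thesis unfolding c_def[symmetric] L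
  proof (intro exI allI impI)
    fix s :: real assume s: "s \<ge> 0"
    have "exp (- (a * s) * c0) * ?m (a * s) * (exp (- (b * s) * c0) * ?m (b * s))
       = exp (- (a * s) * c0) * exp (- (b * s) * c0) * (?m (a * s) * ?m (b * s))" by simp
    also have "\<dots> = (exp (- (a * s) * c0) * exp (- (b * s) * c0) * exp (- s * d)) * ?m (c * s)"
      unfolding m[OF s] by simp
    also have "exp (- (a * s) * c0) * exp (- (b * s) * c0) * exp (- s * d)
       = exp (- (c * s) * c0) * exp ((c * c0 - a * c0 - b * c0 - d) * s)"
      by (simp add: algebra_simps flip: exp_add)
    finally show "exp (- (a * s) * c0) * ?m (a * s) * (exp (- (b * s) * c0) * ?m (b * s))
      = exp (- (c * s) * c0) * ?m (c * s) * exp ((c * c0 - a * c0 - b * c0 - d) * s)" by simp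
  qed
qed

lemma stable_nondegenerate: "\<nexists>c. \<mu> = return borel c"
  using stable by (simp add: stable_law_def)

lemma stable_shift_not_zero:
  assumes "AE x in distr \<mu> borel (\<lambda>z. z + c0). x = 0"
  shows False
proof -
  interpret real_distribution \<mu> by (rule stable_real_distribution)
  have "AE z in \<mu>. z + c0 = 0" using assms by (subst (asm) AE_distr_iff) auto
  then have "AE z in \<mu>. - c0 = z" by eventually_elim simp
  then show False using eq_return_if_AE_eq stable_nondegenerate by blast
qed

end

text \<open>
  Equality in the Cauchy-Schwarz inequality: \<open>exp (- x)\<close> has variance 0.
\<close>

lemma (in real_distribution) zero_if_exp_moments_1:
  assumes int: "integrable M (\<lambda>x. exp (- 1 * x))" "integrable M (\<lambda>x. exp (- 2 * x))"
    and one: "(LINT x|M. exp (- 1 * x)) = 1" "(LINT x|M. exp (- 2 * x)) = 1"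
  shows "AE x in M. x = 0"
proof -
  have sq: "(exp (- 1 * x) - 1)\<^sup>2 = exp (- 2 * x) - 2 * exp (- 1 * x) + 1" for x :: real
  proof -
    have "exp (- 2 * x) = exp (- 1 * x) * exp (- 1 * x)" by (simp flip: exp_add)
    then show ?thesis by (simp add: power2_eq_square algebra_simps)
  qed
  have i: "integrable M (\<lambda>x. exp (- 2 * x) - 2 * exp (- 1 * x))"
    using int by (intro Bochner_Integration.integrable_diff integrable_mult_right)
  have "(LINT x|M. (exp (- 1 * x) - 1)\<^sup>2) = (LINT x|M. exp (- 2 * x) - 2 * exp (- 1 * x)) + 1"
    unfolding sq using i prob_space by (subst Bochner_Integration.integral_add) auto
  also have "(LINT x|M. exp (- 2 * x) - 2 * exp (- 1 * x)) = 1 - 2 * 1"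
    using int by (subst Bochner_Integration.integral_diff) (auto simp: one[simplified])
  finally have "(LINT x|M. (exp (- 1 * x) - 1)\<^sup>2) = 0" by simp
  moreover have "integrable M (\<lambda>x. (exp (- 1 * x) - 1)\<^sup>2)"
    unfolding sq by (intro Bochner_Integration.integrable_add i) simp
  ultimately have "AE x in M. (exp (- 1 * x) - 1)\<^sup>2 = 0"
    by (subst (asm) integral_nonneg_eq_0_iff_AE) auto
  then show ?thesis by eventually_elim simp
qed

section \<open>From the Laplace transform to the characteristic function\<close>

definition laplace :: "real measure \<Rightarrow> complex \<Rightarrow> complex" where
  "laplace M w = (CLINT x|M. exp (- w * of_real x))"

lemma norm_exp_minus_one_le: "norm (exp z - 1) \<le> norm z * exp (norm z)" for z :: complex
proof -
  have "norm (exp z - exp 0) \<le> exp (norm z) * norm (z - 0)"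
  proof (rule field_differentiable_bound[where S = "cball 0 (norm z)" and f' = exp])
    show "norm (exp w) \<le> exp (norm z)" if "w \<in> cball 0 (norm z)" for w :: complex
    proof -
      have "norm w \<le> norm z" using that by simp
      then show ?thesis using norm_exp[of w] by (metis exp_le_cancel_iff order_trans)
    qed
  qed (auto intro!: derivative_eq_intros)
  then show ?thesis by (simp add: mult.commute)
qed

context real_distribution
begin

lemma laplace_integrable:
  assumes int: "\<And>s. s \<ge> 0 \<Longrightarrow> integrable M (\<lambda>x. exp (- s * x))" and w: "Re w \<ge> 0"
  shows "integrable M (\<lambda>x. exp (- w * complex_of_real x))"
  by (rule Bochner_Integration.integrable_bound[OF int[OF w]]) auto

text \<open>
  Differentiation under the integral: near \<open>w\<close> the difference quotients are dominated through
  the exponential moments at \<open>Re w - 2 e\<close> and \<open>Re w + 2 e\<close> with \<open>e = Re w / 4\<close>.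
\<close>

lemma laplace_has_derivative:
  assumes int: "\<And>s. s \<ge> 0 \<Longrightarrow> integrable M (\<lambda>x. exp (- s * x))" and w: "Re w > 0"
  shows "(laplace M has_field_derivative (CLINT x|M. - of_real x * exp (- w * of_real x))) (at w)"
proof -
  define e where "e = Re w / 4"
  have e: "e > 0" using w by (simp add: e_def)
  let ?q = "\<lambda>h x. (exp (- (w + h) * of_real x) - exp (- w * of_real x)) / h"
  let ?g = "\<lambda>x. (exp (- (Re w - 2 * e) * x) + exp (- (Re w + 2 * e) * x)) / e"
  have bound: "norm (?q h x) \<le> ?g x" if h: "h \<noteq> 0" "norm h < e" for h and x :: real
  proof -
    have eq: "?q h x = exp (- w * of_real x) * ((exp (- h * of_real x) - 1) / h)"
      by (simp add: algebra_simps diff_divide_distrib flip: exp_add)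
    have "norm ((exp (- h * complex_of_real x) - 1) / h) \<le> \<bar>x\<bar> * exp (norm h * \<bar>x\<bar>)"
      using norm_exp_minus_one_le[of "- h * complex_of_real x"] h
      by (simp add: norm_divide norm_mult field_simps)
    also have "\<dots> \<le> (exp (e * \<bar>x\<bar>) / e) * exp (e * \<bar>x\<bar>)"
    proof (intro mult_mono)
      show "\<bar>x\<bar> \<le> exp (e * \<bar>x\<bar>) / e"
        using exp_ge_add_one_self[of "e * \<bar>x\<bar>"] e
        by (simp add: pos_le_divide_eq mult.commute del: exp_ge_add_one_self)
      show "exp (norm h * \<bar>x\<bar>) \<le> exp (e * \<bar>x\<bar>)"
        using h by (simp add: mult_right_mono)
    qed (use e in auto)
    also have "\<dots> = exp (2 * e * \<bar>x\<bar>) / e"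
      by (simp flip: exp_add)
    finally have "norm (?q h x) \<le> exp (- Re w * x) * (exp (2 * e * \<bar>x\<bar>) / e)"
      unfolding eq norm_mult by (intro mult_mono) auto
    also have "\<dots> = exp (- Re w * x + 2 * e * \<bar>x\<bar>) / e"
      unfolding exp_add by simp
    also have "exp (- Re w * x + 2 * e * \<bar>x\<bar>)
        \<le> exp (- (Re w - 2 * e) * x) + exp (- (Re w + 2 * e) * x)"
    proof (cases "x \<ge> 0")
      case True
      then have "exp (- Re w * x + 2 * e * \<bar>x\<bar>) = exp (- (Re w - 2 * e) * x)"
        by (simp add: algebra_simps)
      then show ?thesis by simp
    next
      case False
      then have "exp (- Re w * x + 2 * e * \<bar>x\<bar>) = exp (- (Re w + 2 * e) * x)"
        by (simp add: algebra_simps)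
      then show ?thesis by simp
    qed
    finally show ?thesis using e by (simp add: divide_right_mono)
  qed
  have g: "integrable M ?g"
    using int[of "Re w - 2 * e"] int[of "Re w + 2 * e"] e w
    by (intro integrable_divide Bochner_Integration.integrable_add) (auto simp: e_def)
  have "((\<lambda>h. (laplace M (w + h) - laplace M w) / h) \<longlongrightarrow>
        (CLINT x|M. - of_real x * exp (- w * of_real x))) (at 0)"
    unfolding tendsto_at_iff_sequentially comp_def
  proof safe
    fix X :: "nat \<Rightarrow> complex" assume X: "\<forall>i. X i \<in> UNIV - {0}" "X \<longlonglongrightarrow> 0"
    have "\<forall>\<^sub>F n in sequentially. norm (X n) < e"
      using tendstoD[OF X(2) e] by simp
    then obtain N where N: "\<And>n. n \<ge> N \<Longrightarrow> norm (X n) < e"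
      by (auto simp: eventually_sequentially)
    have "(\<lambda>n. CLINT x|M. ?q (X (n + N)) x) \<longlonglongrightarrow>
       (CLINT x|M. - of_real x * exp (- w * of_real x))"
    proof (rule integral_dominated_convergence[where w = ?g])
      show "AE x in M. (\<lambda>n. ?q (X (n + N)) x) \<longlonglongrightarrow> - of_real x * exp (- w * of_real x)"
      proof (rule AE_I2)
        fix x
        have "((\<lambda>v. exp (- v * of_real x)) has_field_derivative
            - of_real x * exp (- w * of_real x)) (at w)"
          by (auto intro!: derivative_eq_intros)
        then have "((\<lambda>h. ?q h x) \<longlongrightarrow> - of_real x * exp (- w * of_real x)) (at 0)"
            unfolding DERIV_def .
        moreover have "filterlim (\<lambda>n. X (n + N)) (at 0) sequentially"
          using X by (auto simp: filterlim_at intro: LIMSEQ_ignore_initial_segment)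
        ultimately show "(\<lambda>n. ?q (X (n + N)) x) \<longlonglongrightarrow> - of_real x * exp (- w * of_real x)"
          by (rule filterlim_compose)
      qed
      show "AE x in M. norm (?q (X (n + N)) x) \<le> ?g x" for n
        using bound[of "X (n + N)"] X(1) N[of "n + N"] by auto
    qed (use g in auto)
    moreover have "(CLINT x|M. ?q (X (n + N)) x)
        = (laplace M (w + X (n + N)) - laplace M w) / X (n + N)" for n
    proof -
      have "\<bar>Re (X (n + N))\<bar> < e" using N[of "n + N"] abs_Re_le_cmod[of "X (n + N)"] by simp
      then have "Re (w + X (n + N)) \<ge> 0" using w by (auto simp: e_def)
      then show ?thesis unfolding laplace_def
        using laplace_integrable[OF int, of "w + X (n + N)"] laplace_integrable[OF int, of w] w
        by (simp add: Bochner_Integration.integral_diff)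
    qed
    ultimately have "(\<lambda>n. (laplace M (w + X (n + N)) - laplace M w) / X (n + N)) \<longlonglongrightarrow>
       (CLINT x|M. - of_real x * exp (- w * of_real x))" by (simp only:)
    then show "(\<lambda>n. (laplace M (w + X n) - laplace M w) / X n) \<longlonglongrightarrow>
       (CLINT x|M. - of_real x * exp (- w * of_real x))"
      by (rule LIMSEQ_offset)
  qed
  then show ?thesis by (simp add: DERIV_def)
qed

lemma laplace_holomorphic:
  assumes int: "\<And>s. s \<ge> 0 \<Longrightarrow> integrable M (\<lambda>x. exp (- s * x))"
  shows "laplace M holomorphic_on {w. Re w > 0}"
  using laplace_has_derivative[OF int]
  by (auto simp: holomorphic_on_open open_halfspace_Re_gt)

text \<open>
  The continuation reaches the imaginary axis through dominated convergence from the right.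
\<close>

lemma laplace_boundary:
  assumes int: "\<And>s. s \<ge> 0 \<Longrightarrow> integrable M (\<lambda>x. exp (- s * x))"
  shows "(\<lambda>n. laplace M (Complex (1 / real (Suc n)) t)) \<longlonglongrightarrow> char M (- t)"
proof -
  have "(\<lambda>n. CLINT x|M. exp (- Complex (1 / real (Suc n)) t * of_real x)) \<longlonglongrightarrow>
     (CLINT x|M. iexp (- t * x))"
  proof (rule integral_dominated_convergence[where w = "\<lambda>x. 1 + exp (- 1 * x)"])
    show "integrable M (\<lambda>x. 1 + exp (- 1 * x))" using int[of 1] by simp
    show "AE x in M. (\<lambda>n. exp (- Complex (1 / real (Suc n)) t * of_real x)) \<longlonglongrightarrow> iexp (- t * x)"
    proof (rule AE_I2)
      fix x
      have "(\<lambda>n. - Complex (1 / real (Suc n)) t * of_real x) \<longlonglongrightarrow> - Complex 0 t * of_real x"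
        by (intro tendsto_intros tendsto_Complex LIMSEQ_Suc[OF lim_1_over_n])
      moreover have "- Complex 0 t * of_real x = \<i> * of_real (- t * x)"
        by (simp add: complex_eq_iff)
      ultimately show "(\<lambda>n. exp (- Complex (1 / real (Suc n)) t * of_real x)) \<longlonglongrightarrow> iexp (- t * x)"
        by (metis tendsto_exp)
    qed
    show "AE x in M. norm (exp (- Complex (1 / real (Suc n)) t * of_real x)) \<le> 1 + exp (- 1 * x)" for n
    proof (rule AE_I2)
      fix x
      show "norm (exp (- Complex (1 / real (Suc n)) t * of_real x)) \<le> 1 + exp (- 1 * x)"
      proof (cases "x \<ge> 0")
        case True
        then have "- (1 / real (Suc n)) * x \<le> 0" by simp
        then have "exp (- (1 / real (Suc n)) * x) \<le> 1" by (metis exp_le_one_iff)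
        then show ?thesis by (simp add: add_increasing2)
      next
        case False
        then have "- (1 / real (Suc n)) * x \<le> - 1 * x"
          by (intro mult_right_mono_neg) auto
        then have "exp (- (1 / real (Suc n)) * x) \<le> exp (- 1 * x)" by (metis exp_le_cancel_iff)
        then show ?thesis by (simp add: add_increasing)
      qed
    qed
  qed simp_all
  then show ?thesis by (simp add: laplace_def char_def)
qed

text \<open>
  Both sides are holomorphic in the right half-plane and agree on the positive reals, hence
  everywhere; on the imaginary axis \<open>(\<i> t) powr \<alpha>\<close> has argument \<open>\<pi> \<alpha> / 2\<close>.
\<close>

lemma char_of_laplace_powr:
  assumes int: "\<And>s. s \<ge> 0 \<Longrightarrow> integrable M (\<lambda>x. exp (- s * x))"
    and L: "\<And>s. s > 0 \<Longrightarrow> (LINT x|M. exp (- s * x)) = exp (\<gamma> * s powr \<alpha>)"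
    and t: "t > 0"
  shows "char M (- t) = exp (of_real (\<gamma> * t powr \<alpha>) * cis (pi * \<alpha> / 2))"
proof -
  let ?S = "{w. Re w > 0}" and ?U = "complex_of_real ` {0<..}"
  let ?f = "\<lambda>w. laplace M w - exp (of_real \<gamma> * w powr of_real \<alpha>)"
  have zero: "?f w = 0" if "w \<in> ?S" for w
  proof (rule analytic_continuation[where f = ?f and S = ?S and U = ?U and \<xi> = 1])
    show "?f holomorphic_on ?S"
      by (intro holomorphic_intros laplace_holomorphic int) (auto simp: complex_nonpos_Reals_iff)
    show "connected ?S" by (intro convex_connected convex_halfspace_Re_gt)
    have "(\<lambda>n. complex_of_real (1 + 1 / real (Suc n))) \<longlonglongrightarrow> of_real (1 + 0)"
      by (intro tendsto_intros LIMSEQ_Suc[OF lim_1_over_n])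
    then show "(1::complex) islimpt ?U"
      unfolding islimpt_sequential
      by (intro exI[of _ "\<lambda>n. complex_of_real (1 + 1 / real (Suc n))"]) (auto simp del: of_real_add intro!: imageI add_pos_pos)
    show "?f z = 0" if "z \<in> ?U" for z
    proof -
      from that obtain s where s: "s > 0" "z = of_real s" by auto
      have "laplace M z = of_real (LINT x|M. exp (- s * x))"
        unfolding laplace_def s by (simp flip: exp_of_real integral_complex_of_real)
      then show ?thesis using s L[of s] by (simp add: powr_of_real flip: exp_of_real)
    qed
  qed (use that in \<open>auto simp: open_halfspace_Re_gt\<close>)
  have "(\<lambda>n. exp (of_real \<gamma> * Complex (1 / real (Suc n)) t powr of_real \<alpha>)) \<longlonglongrightarrow>
     exp (of_real \<gamma> * Complex 0 t powr of_real \<alpha>)"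
    using t by (intro tendsto_intros tendsto_Complex LIMSEQ_Suc[OF lim_1_over_n])
      (auto simp: complex_nonpos_Reals_iff)
  moreover have "exp (of_real \<gamma> * Complex (1 / real (Suc n)) t powr of_real \<alpha>)
      = laplace M (Complex (1 / real (Suc n)) t)" for n
    using zero[of "Complex (1 / real (Suc n)) t"] by simp
  ultimately have "(\<lambda>n. laplace M (Complex (1 / real (Suc n)) t)) \<longlonglongrightarrow>
     exp (of_real \<gamma> * Complex 0 t powr of_real \<alpha>)" by simp
  then have "char M (- t) = exp (of_real \<gamma> * Complex 0 t powr of_real \<alpha>)"
    using laplace_boundary[OF int, of t] LIMSEQ_unique by blast
  also have "Complex 0 t powr of_real \<alpha> = of_real (t powr \<alpha>) * cis (pi * \<alpha> / 2)"
  proof -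
    have "Complex 0 t = \<i> * of_real t" by (simp add: complex_eq_iff)
    moreover have "Ln (\<i> * of_real t) = of_real (ln t) + \<i> * of_real (pi / 2)"
      using Ln_times_of_real[OF t, of \<i>] t by (simp add: Ln_of_real mult.commute)
    ultimately show ?thesis using t
      by (simp add: powr_def cis_conv_exp exp_of_real exp_add ring_distribs mult_ac flip: exp_of_real)
  qed
  finally show ?thesis by (simp add: mult.assoc)
qed

end

section \<open>The mass of the positive half-line\<close>

text \<open>
  Up to the factors \<open>t\<close> and \<open>\<alpha>\<close>, the derivative of the imaginary part in the angle and that of
  the real part in the radius coincide. This Cauchy-Riemann relation makes the rotation of the
  ray computable.
\<close>

lemma stable_exponent_derivatives:
  fixes \<gamma> \<alpha> t \<eta> :: real
  defines "E \<equiv> \<lambda>t \<eta>. exp (of_real (\<gamma> * t powr \<alpha>) * cis \<eta>)"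
    and "G \<equiv> \<lambda>t \<eta>. Re (of_real (\<gamma> * t powr (\<alpha> - 1)) * cis \<eta> * exp (of_real (\<gamma> * t powr \<alpha>) * cis \<eta>))"
  assumes t: "t > 0"
  shows "((\<lambda>\<eta>. Im (E t \<eta>)) has_vector_derivative t * G t \<eta>) (at \<eta> within A)"
    and "((\<lambda>t. Re (E t \<eta>)) has_vector_derivative \<alpha> * G t \<eta>) (at t)"
proof -
  have E: "E t \<eta> = of_real (exp (\<gamma> * t powr \<alpha> * cos \<eta>)) * cis (\<gamma> * t powr \<alpha> * sin \<eta>)" for t \<eta>
    by (simp add: E_def complex_eq_iff Re_exp Im_exp)
  have G: "G t \<eta> = \<gamma> * t powr (\<alpha> - 1) * exp (\<gamma> * t powr \<alpha> * cos \<eta>) *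
      (cos \<eta> * cos (\<gamma> * t powr \<alpha> * sin \<eta>) - sin \<eta> * sin (\<gamma> * t powr \<alpha> * sin \<eta>))" for t \<eta>
    by (simp add: G_def Re_exp Im_exp algebra_simps)
  show "((\<lambda>\<eta>. Im (E t \<eta>)) has_vector_derivative t * G t \<eta>) (at \<eta> within A)"
  proof -
    have tt: "t powr \<alpha> = t * t powr (\<alpha> - 1)"
      using powr_mult_base[of t "\<alpha> - 1"] t by simp
    show ?thesis unfolding E G tt
      by (auto intro!: derivative_eq_intros simp: algebra_simps
          simp flip: has_real_derivative_iff_has_vector_derivative)
  qed
  show "((\<lambda>t. Re (E t \<eta>)) has_vector_derivative \<alpha> * G t \<eta>) (at t)"
    unfolding E G using t
    by (auto intro!: derivative_eq_intros simp: algebra_simps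
        simp flip: has_real_derivative_iff_has_vector_derivative)
qed

text \<open>
  Writing the integrand as an integral of its derivative in the angle, from \<open>\<theta>\<close> to \<open>\<pi>\<close> where the
  imaginary part vanishes, and exchanging the integrations leaves an exact derivative in the
  radius.
\<close>

lemma integral_Im_stable_exponent:
  fixes \<gamma> \<alpha> T \<theta> :: real
  assumes \<alpha>: "1 < \<alpha>" and T: "T \<ge> 0" and \<theta>: "\<theta> \<le> pi"
  shows "((\<lambda>t. Im (exp (of_real (\<gamma> * t powr \<alpha>) * cis \<theta>)) / t) has_integral
    integral {\<theta>..pi} (\<lambda>\<eta>. 1 - Re (exp (of_real (\<gamma> * T powr \<alpha>) * cis \<eta>))) / \<alpha>) {0..T}"
proof -
  let ?E = "\<lambda>t \<eta>. exp (of_real (\<gamma> * t powr \<alpha>) * cis \<eta>)"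
  let ?G = "\<lambda>t \<eta>. Re (of_real (\<gamma> * t powr (\<alpha> - 1)) * cis \<eta> * ?E t \<eta>)"
  have contG: "continuous_on ({0..T} \<times> {\<theta>..pi}) (\<lambda>(t, \<eta>). ?G t \<eta>)"
    unfolding split_beta using \<alpha>
    by (intro continuous_intros continuous_on_powr') auto
  have angle: "integral {\<theta>..pi} (?G t) = - (Im (?E t \<theta>) / t)" if t: "t \<in> {0..T}" for t
  proof (cases "t = 0")
    case False
    then have "t > 0" using t by simp
    have "((\<lambda>\<eta>. t * ?G t \<eta>) has_integral Im (?E t pi) - Im (?E t \<theta>)) {\<theta>..pi}"
      by (rule fundamental_theorem_of_calculus[OF \<theta>])
         (rule stable_exponent_derivatives(1)[OF \<open>t > 0\<close>])
    then have "((\<lambda>\<eta>. (1 / t) * (t * ?G t \<eta>)) has_integral (1 / t) * (Im (?E t pi) - Im (?E t \<theta>))) {\<theta>..pi}"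
      by (rule has_integral_mult_right)
    moreover have "Im (?E t pi) = 0" by (simp add: Im_exp)
    ultimately have "(?G t has_integral - (Im (?E t \<theta>) / t)) {\<theta>..pi}"
      using \<open>t > 0\<close> by simp
    then show ?thesis by (rule integral_unique)
  qed (use \<alpha> in simp)
  have radial: "integral {0..T} (\<lambda>t. ?G t \<eta>) = (Re (?E T \<eta>) - 1) / \<alpha>" for \<eta>
  proof -
    have "((\<lambda>t. \<alpha> * ?G t \<eta>) has_integral Re (?E T \<eta>) - Re (?E 0 \<eta>)) {0..T}"
    proof (rule fundamental_theorem_of_calculus_interior[OF T])
      show "continuous_on {0..T} (\<lambda>t. Re (?E t \<eta>))"
        using \<alpha> by (intro continuous_intros continuous_on_powr') auto
    qed (rule stable_exponent_derivatives(2), simp)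
    then have "((\<lambda>t. (1 / \<alpha>) * (\<alpha> * ?G t \<eta>)) has_integral (1 / \<alpha>) * (Re (?E T \<eta>) - Re (?E 0 \<eta>))) {0..T}"
      by (rule has_integral_mult_right)
    then show ?thesis using \<alpha> by (simp add: integral_unique)
  qed
  have "continuous_on {0..T} (\<lambda>t. integral {\<theta>..pi} (?G t))"
    using integral_continuous_on_param[of "{0..T}" \<theta> pi ?G] contG by simp
  then have "(\<lambda>t. integral {\<theta>..pi} (?G t)) integrable_on {0..T}"
    by (rule integrable_continuous_interval)
  then have "((\<lambda>t. integral {\<theta>..pi} (?G t)) has_integral
      integral {0..T} (\<lambda>t. integral {\<theta>..pi} (?G t))) {0..T}"
    by (rule integrable_integral)
  moreover have "integral {0..T} (\<lambda>t. integral {\<theta>..pi} (?G t))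
      = integral {\<theta>..pi} (\<lambda>\<eta>. integral {0..T} (\<lambda>t. ?G t \<eta>))"
    using integral_swap_continuous[of 0 \<theta> T pi ?G] contG by (simp add: cbox_Pair_eq)
  ultimately have "((\<lambda>t. integral {\<theta>..pi} (?G t)) has_integral
      integral {\<theta>..pi} (\<lambda>\<eta>. (Re (?E T \<eta>) - 1) / \<alpha>)) {0..T}"
    unfolding radial by (simp only:)
  then have "((\<lambda>t. - integral {\<theta>..pi} (?G t)) has_integral
      - integral {\<theta>..pi} (\<lambda>\<eta>. (Re (?E T \<eta>) - 1) / \<alpha>)) {0..T}"
    by (rule has_integral_neg)
  moreover have "- integral {\<theta>..pi} (\<lambda>\<eta>. (Re (?E T \<eta>) - 1) / \<alpha>)
      = integral {\<theta>..pi} (\<lambda>\<eta>. 1 - Re (?E T \<eta>)) / \<alpha>"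
    by (simp flip: integral_neg integral_divide add: minus_divide_left)
  ultimately show ?thesis
    using angle by (subst has_integral_cong[where g = "\<lambda>t. - integral {\<theta>..pi} (?G t)"]) auto
qed

lemma integral_stable_exponent_limit:
  fixes \<gamma> \<alpha> \<theta> :: real
  assumes \<alpha>: "1 < \<alpha>" and \<gamma>: "\<gamma> > 0" and \<theta>: "pi / 2 < \<theta>" "\<theta> \<le> pi"
  shows "(\<lambda>n. integral {\<theta>..pi} (\<lambda>\<eta>. 1 - Re (exp (of_real (\<gamma> * real n powr \<alpha>) * cis \<eta>))))
     \<longlonglongrightarrow> pi - \<theta>"
proof -
  let ?f = "\<lambda>n \<eta>. 1 - Re (exp (of_real (\<gamma> * real n powr \<alpha>) * cis \<eta>))"
  have cos: "cos \<eta> < 0" if "\<eta> \<in> {\<theta>..pi}" for \<eta>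
    using that \<theta> cos_monotone_0_pi[of "pi/2" \<eta>] by auto
  have "(\<lambda>n. integral {\<theta>..pi} (?f n)) \<longlonglongrightarrow> integral {\<theta>..pi} (\<lambda>_. 1)"
  proof (rule dominated_convergence(2)[where h = "\<lambda>_. 2"])
    show "?f n integrable_on {\<theta>..pi}" for n
      by (intro integrable_continuous_interval continuous_intros)
    show "norm (?f n \<eta>) \<le> 2" if "\<eta> \<in> {\<theta>..pi}" for n \<eta>
    proof -
      have "\<bar>Re (exp (of_real (\<gamma> * real n powr \<alpha>) * cis \<eta>))\<bar> \<le> exp (\<gamma> * real n powr \<alpha> * cos \<eta>)"
        by (rule order_trans[OF abs_Re_le_cmod]) simp
      also have "\<dots> \<le> 1" using cos[OF that] \<gamma> by (simp add: mult_nonneg_nonpos)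
      finally show ?thesis by auto
    qed
    show "(\<lambda>n. ?f n \<eta>) \<longlonglongrightarrow> 1" if "\<eta> \<in> {\<theta>..pi}" for \<eta>
    proof -
      have "filterlim (\<lambda>n. real n powr \<alpha>) at_top sequentially"
        using \<alpha> by real_asymp
      then have "filterlim (\<lambda>n. (\<gamma> * cos \<eta>) * real n powr \<alpha>) at_bot sequentially"
        using cos[OF that] \<gamma>
        by (intro filterlim_tendsto_neg_mult_at_bot[OF tendsto_const]) (auto simp: mult_pos_neg)
      then have *: "(\<lambda>n. exp ((\<gamma> * cos \<eta>) * real n powr \<alpha>)) \<longlonglongrightarrow> 0"
        by (rule filterlim_compose[OF exp_at_bot])
      have "(\<lambda>n. Re (exp (of_real (\<gamma> * real n powr \<alpha>) * cis \<eta>))) \<longlonglongrightarrow> 0"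
        by (rule Lim_null_comparison[OF _ *], rule always_eventually, rule allI)
           (rule order_trans, unfold real_norm_def, rule abs_Re_le_cmod, simp add: mult_ac)
      then show ?thesis using tendsto_diff[OF tendsto_const, of _ 0 sequentially 1] by simp
    qed
  qed (auto intro: integrable_const_ivl)
  then show ?thesis using \<theta> by simp
qed

text \<open>
  Smoothing with a Gaussian: \<open>E exp (- (n x)\<^sup>2 / 2)\<close> dominates the atom and equals the average
  of the characteristic function at \<open>n\<close> times a standard normal variable.
\<close>

lemma (in real_distribution) no_atom_if_char_vanishes:
  assumes "(char M \<longlongrightarrow> 0) at_infinity"
  shows "measure M {0} = 0"
proof -
  interpret N: real_distribution std_normal_distribution by (rule real_dist_normal_dist)
  interpret P: pair_prob_space M std_normal_distribution ..
  let ?N = std_normal_distribution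
  have bound: "measure M {0} \<le> norm (CLINT t|?N. char M (real n * t))" for n
  proof -
    have "(CLINT t|?N. char M (real n * t)) = (CLINT t|?N. (CLINT x|M. iexp (real n * t * x)))"
      by (simp add: char_def)
    also have "\<dots> = (CLINT x|M. (CLINT t|?N. iexp (real n * t * x)))"
      by (rule P.Fubini_integral) 
         (auto intro!: P.integrable_const_bound[where B = 1] simp: split_beta)
    also have "\<dots> = (CLINT x|M. char ?N (real n * x))"
      by (simp add: char_def mult_ac)
    also have "\<dots> = of_real (LINT x|M. exp (- (real n * x)\<^sup>2 / 2))"
      by (simp add: char_std_normal_distribution)
    finally have eq: "(CLINT t|?N. char M (real n * t)) = of_real (LINT x|M. exp (- (real n * x)\<^sup>2 / 2))" .
    have "measure M {0} = (LINT x|M. indicator {0} x)" by simp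
    also have "\<dots> \<le> (LINT x|M. exp (- (real n * x)\<^sup>2 / 2))"
      by (intro integral_mono integrable_const_bound[where B = 1])
         (auto split: split_indicator)
    finally show ?thesis unfolding eq by simp
  qed
  have "(\<lambda>n. CLINT t|?N. char M (real n * t)) \<longlonglongrightarrow> (CLINT t|?N. 0)"
  proof (rule integral_dominated_convergence[where w = "\<lambda>_. 1"])
    have "AE t in lborel. t \<noteq> (0::real)" by (rule AE_lborel_singleton)
    then have "AE t in ?N. t \<noteq> 0" by (subst AE_density) auto
    then show "AE t in ?N. (\<lambda>n. char M (real n * t)) \<longlonglongrightarrow> 0"
    proof eventually_elim
      case (elim t)
      have "filterlim (\<lambda>n. real n * t) at_infinity sequentially"
        using elim by (intro tendsto_mult_filterlim_at_infinity[OF tendsto_const, of t, simplified mult.commute[of t]]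
            filterlim_at_top_imp_at_infinity filterlim_real_sequentially)
      then show ?case by (rule filterlim_compose[OF assms])
    qed
  qed (auto intro: cmod_char_le_1)
  then have "(\<lambda>n. norm (CLINT t|?N. char M (real n * t))) \<longlonglongrightarrow> 0"
    by (auto intro: tendsto_norm_zero)
  then have "measure M {0} \<le> 0"
    by (rule LIMSEQ_le_const) (use bound in auto)
  then show ?thesis using measure_nonneg[of M "{0}"] by linarith
qed

text \<open>
  The expectation of \<open>sgn x * Si (n \<bar>x\<bar>)\<close> tends to \<open>\<pi>/2\<close> times that of \<open>sgn x\<close>; by Fubini it is
  an integral of the imaginary part of the characteristic function, whose limit is known from
  the rotation of the ray. Integrability of \<open>x\<close> justifies Fubini near \<open>t = 0\<close>.
\<close>

theorem (in real_distribution) positivity_of_laplace_powr: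
  assumes int: "\<And>s. s \<ge> 0 \<Longrightarrow> integrable M (\<lambda>x. exp (- s * x))"
    and int1: "integrable M (\<lambda>x. x)"
    and L: "\<And>s. s > 0 \<Longrightarrow> (LINT x|M. exp (- s * x)) = exp (\<gamma> * s powr \<alpha>)"
    and \<alpha>: "1 < \<alpha>" "\<alpha> \<le> 2" and \<gamma>: "\<gamma> > 0"
  shows "measure M {0} = 0" and "measure M {0<..} = 1 - 1 / \<alpha>"
proof -
  define \<theta> where "\<theta> = pi * \<alpha> / 2"
  have \<theta>: "pi / 2 < \<theta>" "\<theta> \<le> pi" using \<alpha> by (auto simp: \<theta>_def)
  have cos: "cos \<theta> < 0" using \<theta> cos_monotone_0_pi[of "pi/2" \<theta>] by auto
  have ch: "char M (- t) = exp (of_real (\<gamma> * t powr \<alpha>) * cis \<theta>)" if "t > 0" for t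
    unfolding \<theta>_def using char_of_laplace_powr[OF int L that] by simp
  have norm_ch: "norm (char M t) \<le> exp (\<gamma> * cos \<theta> * \<bar>t\<bar> powr \<alpha>)" if "t \<noteq> 0" for t
  proof -
    have "norm (char M t) = norm (char M (- \<bar>t\<bar>))"
    proof (cases "t > 0")
      case True
      then show ?thesis by (simp add: char_uminus)
    qed simp
    then show ?thesis using ch[of "\<bar>t\<bar>"] that by (simp add: mult_ac)
  qed
  show atom: "measure M {0} = 0"
  proof (rule no_atom_if_char_vanishes)
    have "filterlim (\<lambda>t::real. \<bar>t\<bar> powr \<alpha>) at_top at_infinity"
      using \<alpha> by (intro filterlim_compose[OF _ filterlim_norm_at_top[where 'a = real, unfolded real_norm_def]]) real_asymp
    then have "filterlim (\<lambda>t::real. (\<gamma> * cos \<theta>) * \<bar>t\<bar> powr \<alpha>) at_bot at_infinity"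
      using cos \<gamma> by (intro filterlim_tendsto_neg_mult_at_bot[OF tendsto_const]) (auto simp: mult_pos_neg)
    then have *: "((\<lambda>t. exp ((\<gamma> * cos \<theta>) * \<bar>t\<bar> powr \<alpha>)) \<longlongrightarrow> 0) at_infinity"
      by (rule filterlim_compose[OF exp_at_bot])
    show "(char M \<longlongrightarrow> 0) at_infinity"
      by (rule Lim_null_comparison[OF _ *])
         (use norm_ch in \<open>auto simp: eventually_at_infinity intro!: exI[of _ 1]\<close>)
  qed
  obtain B where B: "\<And>T. \<bar>Si T\<bar> \<le> B" using bounded_Si by auto
  interpret P: pair_sigma_finite lborel M ..
  let ?I = "\<lambda>n::nat. integral {\<theta>..pi} (\<lambda>\<eta>. 1 - Re (exp (of_real (\<gamma> * real n powr \<alpha>) * cis \<eta>)))"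
  have eq: "(LINT x|M. sgn x * Si (real n * \<bar>x\<bar>)) = - (?I n / \<alpha>)" for n
  proof -
    let ?f = "\<lambda>(t, x). indicator {0<..<real n} t *\<^sub>R (sin (t * x) / t)"
    have fint: "integrable (lborel \<Otimes>\<^sub>M M) ?f"
    proof -
      have "integrable (lborel \<Otimes>\<^sub>M M) (\<lambda>(t::real, x). indicator {0<..<real n} t * x)"
      proof (rule P.Fubini_integrable)
        have "integrable lborel (\<lambda>t::real. indicator {0<..<real n} t * (LINT x|M. \<bar>x\<bar>))"
          by (intro integrable_mult_left integrable_real_indicator) auto
        then show "integrable lborel (\<lambda>t. LINT x|M. norm (case (t, x) of (t::real, x) \<Rightarrow> indicator {0<..<real n} t * x))"
          by (simp add: abs_mult)
        show "AE t in lborel. integrable M (\<lambda>x. case (t, x) of (t::real, x) \<Rightarrow> indicator {0<..<real n} t * x)"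
          using int1 by simp
      qed measurable
      then show ?thesis
        by (rule Bochner_Integration.integrable_bound) 
          (auto split: split_indicator simp: divide_le_eq abs_mult mult.commute intro!: AE_I2 order_trans[OF abs_sin_x_le_abs_x])
    qed
    have inner: "(LINT x|M. ?f (t, x)) = indicator {0<..<real n} t *\<^sub>R (- (Im (exp (of_real (\<gamma> * t powr \<alpha>) * cis \<theta>)) / t))" for t
    proof (cases "t \<in> {0<..<real n}")
      case True
      have "Im (char M (- t)) = (LINT x|M. Im (iexp (- t * x)))"
        unfolding char_def by (rule integral_Im[symmetric]) (rule integrable_iexp, simp_all)
      also have "\<dots> = - (LINT x|M. sin (t * x))" by (simp add: Im_exp)
      finally show ?thesis using True ch[of t] by simp
    qed simp
    have "(LINT x|M. sgn x * Si (real n * \<bar>x\<bar>)) = (LINT x|M. (LINT t|lborel. ?f (t, x)))"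
    proof (rule Bochner_Integration.integral_cong[OF refl])
      fix x
      show "sgn x * Si (real n * \<bar>x\<bar>) = (LINT t|lborel. ?f (t, x))"
        using LBINT_I0c_sin_scale_divide[of "real n" x]
        by (simp add: interval_lebesgue_integral_def set_lebesgue_integral_def zero_ereal_def)
    qed
    also have "\<dots> = (LINT t|lborel. (LINT x|M. ?f (t, x)))"
      by (rule P.Fubini_integral) (use fint in simp)
    also have "\<dots> = (LINT t|lborel. indicator {0<..<real n} t *\<^sub>R (- (Im (exp (of_real (\<gamma> * t powr \<alpha>) * cis \<theta>)) / t)))"
      by (rule Bochner_Integration.integral_cong[OF refl inner])
    also have "\<dots> = integral {0<..<real n} (\<lambda>t. - (Im (exp (of_real (\<gamma> * t powr \<alpha>) * cis \<theta>)) / t))"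
    proof -
      have "set_integrable lborel {0<..<real n} (\<lambda>t. - (Im (exp (of_real (\<gamma> * t powr \<alpha>) * cis \<theta>)) / t))"
      proof -
        have "integrable lborel (\<lambda>t. LINT x|M. ?f (t, x))" using P.integrable_fst'[OF fint] .
        also have "(\<lambda>t. LINT x|M. ?f (t, x)) = (\<lambda>t. indicator {0<..<real n} t *\<^sub>R (- (Im (exp (of_real (\<gamma> * t powr \<alpha>) * cis \<theta>)) / t)))"
        proof
          fix t
          show "(LINT x|M. ?f (t, x)) = indicator {0<..<real n} t *\<^sub>R (- (Im (exp (of_real (\<gamma> * t powr \<alpha>) * cis \<theta>)) / t))"
            by (rule inner)
        qed
        finally show ?thesis unfolding set_integrable_def .
      qed
      then show ?thesis
        using set_borel_integral_eq_integral(2) by (fastforce simp: set_lebesgue_integral_def)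
    qed
    also have "\<dots> = integral {0..real n} (\<lambda>t. - (Im (exp (of_real (\<gamma> * t powr \<alpha>) * cis \<theta>)) / t))"
      by (rule integral_open_interval_real[symmetric])
    also have "\<dots> = - (?I n / \<alpha>)"
      by (rule integral_unique, rule has_integral_neg, rule integral_Im_stable_exponent)
         (use \<alpha> \<theta> in auto)
    finally show ?thesis .
  qed
  have "(\<lambda>n. LINT x|M. sgn x * Si (real n * \<bar>x\<bar>)) \<longlonglongrightarrow> (LINT x|M. sgn x * (pi / 2))"
  proof (rule integral_dominated_convergence[where w = "\<lambda>_. B"])
    show "AE x in M. (\<lambda>n. sgn x * Si (real n * \<bar>x\<bar>)) \<longlonglongrightarrow> sgn x * (pi / 2)"
    proof (rule AE_I2)
      fix x
      show "(\<lambda>n. sgn x * Si (real n * \<bar>x\<bar>)) \<longlonglongrightarrow> sgn x * (pi / 2)"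
      proof (cases "x = 0")
        case False
        then have "filterlim (\<lambda>n. real n * \<bar>x\<bar>) at_top sequentially" by real_asymp
        then show ?thesis by (intro tendsto_intros filterlim_compose[OF Si_at_top])
      qed simp
    qed
    show "AE x in M. norm (sgn x * Si (real n * \<bar>x\<bar>)) \<le> B" for n
      using B order_trans[OF abs_ge_zero B] by (intro AE_I2) (auto simp: abs_mult abs_sgn_eq)
  qed simp_all
  moreover have "(\<lambda>n. LINT x|M. sgn x * Si (real n * \<bar>x\<bar>)) \<longlonglongrightarrow> - ((pi - \<theta>) / \<alpha>)"
    unfolding eq using \<alpha>
    by (intro tendsto_intros integral_stable_exponent_limit \<gamma> \<theta>) auto
  ultimately have "(LINT x|M. sgn x * (pi / 2)) = - ((pi - \<theta>) / \<alpha>)"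
    by (rule LIMSEQ_unique)
  then have "(pi / 2) * (LINT x|M. sgn x) = (pi / 2) * (- (2 / \<alpha> - 1))"
    using \<alpha> by (simp add: \<theta>_def field_simps)
  then have "(LINT x|M. sgn x) = - (2 / \<alpha> - 1)" by (simp only: mult_cancel_left) simp
  moreover have "(LINT x|M. sgn x) = (LINT x|M. indicator {0<..} x - indicator {..<0} x)"
    by (intro Bochner_Integration.integral_cong) (auto simp: sgn_real_def split: split_indicator)
  moreover have "\<dots> = measure M {0<..} - measure M {..<0}"
    by (subst Bochner_Integration.integral_diff) (auto intro!: integrable_real_indicator simp: emeasure_eq_measure)
  moreover have "measure M {..<0} = 1 - measure M {0<..}"
  proof -
    have "measure M (UNIV - {0<..}) = 1 - measure M {0<..}"
      using prob_compl[of "{0<..}"] by simp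
    moreover have "UNIV - {0<..} = {..<0} \<union> {0::real}" by auto
    moreover have "measure M ({..<0} \<union> {0}) = measure M {..<0} + measure M {0}"
      by (intro finite_measure_Union) auto
    ultimately show ?thesis using atom by simp
  qed
  ultimately show "measure M {0<..} = 1 - 1 / \<alpha>" by (simp add: field_simps)
qed

section \<open>The sign of the centred sums\<close>

context mean_one_distribution
begin

lemma char_centred_law:
  "char (centred_law b n) t = iexp (t * (a n - real n / b n)) * char (sum_law b a n) t"
proof -
  have "iexp (t * (a n - real n / b n)) * iexp (- (t * a n)) = iexp (- (t * (real n / b n)))"
    by (simp add: algebra_simps flip: exp_add)
  then show ?thesis
    unfolding centred_law_def char_sum_law by (simp only: mult.assoc[symmetric])
qed

text \<open>
  The same sums are tight under both centrings, so the centrings differ by a bounded amount.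
\<close>

lemma bounded_recentring:
  assumes b: "\<And>n. b n > 0" and \<mu>: "real_distribution \<mu>" and weak: "weak_conv_m (sum_law b a) \<mu>"
    and K: "\<forall>\<^sub>F n in sequentially. (LINT z|centred_law b n. \<bar>z\<bar>) \<le> K"
  shows "Bseq (\<lambda>n. a n - real n / b n)"
proof -
  interpret Q: prob_space "iid M" by (rule prob_space_iid)
  note [measurable] = coordinate_measurable
  obtain r where r: "r > 0" "\<forall>\<^sub>F n in sequentially. (LINT x|sum_law b a n. min 2 (r * \<bar>x\<bar>)) < 1 / 2"
    using weak_conv_tight[OF real_distribution_sum_law \<mu> weak, of "1 / 2"] by auto
  \<comment> \<open>the two truncated means below then add up to less than 1\<close>
  define e where "e = min r (1 / (4 * (\<bar>K\<bar> + 1)))"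
  have e: "e > 0" "e \<le> r" "e * \<bar>K\<bar> \<le> 1 / 4"
  proof -
    have "e * \<bar>K\<bar> \<le> 1 / (4 * (\<bar>K\<bar> + 1)) * (\<bar>K\<bar> + 1)"
      using r by (intro mult_mono) (auto simp: e_def)
    moreover have "1 / (4 * (\<bar>K\<bar> + 1)) * (\<bar>K\<bar> + 1) = 1 / 4" by (simp add: field_simps)
    ultimately show "e * \<bar>K\<bar> \<le> 1 / 4" by linarith
  qed (use r in \<open>auto simp: e_def\<close>)
  have "\<forall>\<^sub>F n in sequentially. norm (a n - real n / b n) \<le> 1 / e"
    using K r(2)
  proof eventually_elim
    case (elim n)
    define c where "c = a n - real n / b n"
    let ?W = "\<lambda>y. (\<Sum>i<n. y i) / b n - a n" and ?Z = "\<lambda>y. (\<Sum>i<n. y i) / b n - real n / b n"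
    have intZ: "integrable (iid M) (\<lambda>y. \<bar>?Z y\<bar>)"
      using integrable_centred_law[of b n] unfolding centred_law_def sum_law_def
      by (subst (asm) integrable_distr_eq) auto
    have intW: "integrable (iid M) (\<lambda>y. min 2 (r * \<bar>?W y\<bar>))"
      using r by (intro Q.integrable_const_bound[where B = 2]) auto
    have EZ: "(LINT y|iid M. \<bar>?Z y\<bar>) = (LINT z|centred_law b n. \<bar>z\<bar>)"
      unfolding centred_law_def sum_law_def by (subst integral_distr) auto
    have EW: "(LINT y|iid M. min 2 (r * \<bar>?W y\<bar>)) = (LINT z|sum_law b a n. min 2 (r * \<bar>z\<bar>))"
      unfolding sum_law_def by (subst integral_distr) auto
    have "min 2 (e * \<bar>c\<bar>) = (LINT y|iid M. min 2 (e * \<bar>c\<bar>))"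
      using Q.prob_space by simp
    also have "\<dots> \<le> (LINT y|iid M. e * \<bar>?Z y\<bar> + min 2 (r * \<bar>?W y\<bar>))"
    proof (rule integral_mono)
      show "min 2 (e * \<bar>c\<bar>) \<le> e * \<bar>?Z y\<bar> + min 2 (r * \<bar>?W y\<bar>)" for y
      proof -
        have "\<bar>c\<bar> \<le> \<bar>?Z y\<bar> + \<bar>?W y\<bar>" by (simp add: c_def)
        then have "e * \<bar>c\<bar> \<le> e * (\<bar>?Z y\<bar> + \<bar>?W y\<bar>)" using e by (intro mult_left_mono) auto
        moreover have "e * \<bar>?W y\<bar> \<le> r * \<bar>?W y\<bar>" using e by (intro mult_right_mono) auto
        moreover have "0 \<le> e * \<bar>?Z y\<bar>" using e by simp
        ultimately show ?thesis unfolding distrib_left by linarith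
      qed
    qed (use intZ intW in auto)
    also have "\<dots> = e * (LINT z|centred_law b n. \<bar>z\<bar>) + (LINT z|sum_law b a n. min 2 (r * \<bar>z\<bar>))"
      using intZ intW by (subst Bochner_Integration.integral_add) (simp_all add: EZ EW)
    also have "\<dots> < 1 / 4 + 1 / 2"
    proof (rule add_le_less_mono)
      have "e * (LINT z|centred_law b n. \<bar>z\<bar>) \<le> e * \<bar>K\<bar>"
        using elim(1) e by (intro mult_left_mono) auto
      then show "e * (LINT z|centred_law b n. \<bar>z\<bar>) \<le> 1 / 4" using e(3) by linarith
    qed (rule elim(2))
    finally have "e * \<bar>c\<bar> \<le> 1" by (auto simp: min_def split: if_splits)
    then show ?case using e by (simp add: c_def field_simps)
  qed
  then show ?thesis by (rule BfunI)
qed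

text \<open>
  The mean-centred sums converge along a further subsequence to a translate of the stable law.
  The uniform bounds on the exponential moments pass to this limit, determine its transform, and
  rule out a drift.
\<close>

lemma subsequential_sign_limit:
  assumes b: "\<And>n. b n > 0" and stable: "stable_law \<alpha> \<mu>" and weak: "weak_conv_m (sum_law b a) \<mu>"
    and \<rho>: "1 < \<rho>" "\<rho> < 2" and \<alpha>: "1 < \<alpha>" "\<alpha> \<le> 2"
    and tm: "\<forall>\<^sub>F n in sequentially. \<forall>k. real n * truncated_moment M (1 / (\<rho> ^ k * b n)) \<le> C / 2 ^ k"
    and r: "strict_mono (r :: nat \<Rightarrow> nat)"
  shows "\<exists>s. strict_mono s \<and>
    (\<lambda>n. measure (centred_law b (r (s n))) {0<..}) \<longlonglongrightarrow> 1 - 1 / \<alpha> \<and>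
    (\<lambda>n. measure (centred_law b (r (s n))) {0..}) \<longlonglongrightarrow> 1 - 1 / \<alpha>"
proof -
  have \<mu>: "real_distribution \<mu>" using stable by (rule stable_real_distribution)
  interpret \<mu>: real_distribution \<mu> by fact
  let ?E = "\<lambda>n s. LINT z|centred_law b n. exp (- s * z)"
  have E_bound: "\<forall>\<^sub>F n in sequentially. ?E n s \<le> exp ((max 1 s)\<^sup>2 * C)" if s: "s \<ge> 0" for s
    using tm
  proof eventually_elim
    case (elim n)
    have "truncated_moment M (s / b n) \<le> truncated_moment M (max 1 s * (1 / b n))"
      using s b[of n] by (intro truncated_moment_mono integrable_id) (auto intro!: divide_right_mono)
    also have "\<dots> \<le> (max 1 s)\<^sup>2 * truncated_moment M (1 / b n)"
      using b[of n] by (intro truncated_moment_scale integrable_id) auto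
    finally have "real n * truncated_moment M (s / b n) \<le> real n * ((max 1 s)\<^sup>2 * truncated_moment M (1 / b n))"
      by (intro mult_left_mono) auto
    also have "\<dots> = (max 1 s)\<^sup>2 * (real n * truncated_moment M (1 / b n))" by simp
    also have "\<dots> \<le> (max 1 s)\<^sup>2 * C" using elim[rule_format, of 0] by (intro mult_left_mono) auto
    finally have le: "real n * truncated_moment M (s / b n) \<le> (max 1 s)\<^sup>2 * C" .
    have "?E n s \<le> exp (real n * truncated_moment M (s / b n))" by (intro exp_moment_centred_law_le s b)
    also have "\<dots> \<le> exp ((max 1 s)\<^sup>2 * C)" using le by (simp only: exp_le_cancel_iff)
    finally show ?case .
  qed
  have E_small: "\<forall>\<^sub>F n in sequentially. ?E n (c / \<rho> ^ k) \<le> exp (C * 2 ^ m / 2 ^ k)"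
    if c: "c > 0" "c \<le> \<rho> ^ m" "m \<le> k" for c m k
    using tm
  proof eventually_elim
    case (elim n)
    have pow: "\<rho> ^ k = \<rho> ^ m * \<rho> ^ (k - m)" "(2::real) ^ k = 2 ^ m * 2 ^ (k - m)"
      using c by (auto simp flip: power_add)
    have "c / \<rho> ^ k / b n \<le> \<rho> ^ m / \<rho> ^ k / b n"
      using c \<rho> b[of n] by (intro divide_right_mono) auto
    also have "\<dots> = 1 / (\<rho> ^ (k - m) * b n)" unfolding pow using \<rho> by simp
    finally have "truncated_moment M (c / \<rho> ^ k / b n) \<le> truncated_moment M (1 / (\<rho> ^ (k - m) * b n))"
      using c \<rho> b[of n] by (intro truncated_moment_mono integrable_id) auto
    then have "real n * truncated_moment M (c / \<rho> ^ k / b n) \<le> real n * truncated_moment M (1 / (\<rho> ^ (k - m) * b n))"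
      by (intro mult_left_mono) auto
    also have "\<dots> \<le> C / 2 ^ (k - m)" using elim by blast
    also have "\<dots> = C * 2 ^ m / 2 ^ k" unfolding pow by simp
    finally have le: "real n * truncated_moment M (c / \<rho> ^ k / b n) \<le> C * 2 ^ m / 2 ^ k" .
    have "?E n (c / \<rho> ^ k) \<le> exp (real n * truncated_moment M (c / \<rho> ^ k / b n))"
      using c \<rho> by (intro exp_moment_centred_law_le b) simp
    also have "\<dots> \<le> exp (C * 2 ^ m / 2 ^ k)" using le by (simp only: exp_le_cancel_iff)
    finally show ?case .
  qed
  have abs_bound: "\<forall>\<^sub>F n in sequentially. (LINT z|centred_law b n. \<bar>z\<bar>) \<le> 2 * exp C"
    using E_bound[OF zero_le_one]
  proof eventually_elim
    case (elim n)
    then show ?case using abs_moment_centred_law_le[of b n, OF b] by simp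
  qed
  have "Bseq (\<lambda>n. a n - real n / b n)"
    by (rule bounded_recentring[OF b \<mu> weak abs_bound])
  then have "bounded (range (\<lambda>n. a (r n) - real (r n) / b (r n)))"
    by (auto simp: Bseq_eq_bounded intro: bounded_subset)
  then obtain c0 s where s: "strict_mono s" "(\<lambda>n. a (r (s n)) - real (r (s n)) / b (r (s n))) \<longlonglongrightarrow> c0"
    using bounded_imp_convergent_subsequence[of "\<lambda>n. a (r n) - real (r n) / b (r n)"] unfolding comp_def by blast
  define q where "q n = r (s n)" for n
  have q: "strict_mono q" using r s(1) by (simp add: q_def strict_mono_def)
  have ev: "\<forall>\<^sub>F n in sequentially. P (q n)" if "\<forall>\<^sub>F n in sequentially. P n" for P
    using eventually_subseq[OF q that] .
  define L where "L = distr \<mu> borel (\<lambda>z. z + c0)"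
  have L: "real_distribution L" unfolding L_def by (rule \<mu>.real_distribution_distr) measurable
  interpret L: real_distribution L by fact
  have conv: "weak_conv_m (\<lambda>n. centred_law b (q n)) L"
  proof (rule levy_continuity[OF real_distribution_centred_law L])
    fix t
    have "char L t = (CLINT z|\<mu>. iexp (t * c0) * iexp (t * z))"
      unfolding L_def char_def by (subst integral_distr) (auto simp: algebra_simps simp flip: exp_add)
    then have "char L t = iexp (t * c0) * char \<mu> t" by (simp add: char_def)
    moreover have "(\<lambda>n. iexp (t * (a (q n) - real (q n) / b (q n))) * char (sum_law b a (q n)) t) \<longlonglongrightarrow> iexp (t * c0) * char \<mu> t"
      using s(2) unfolding q_def[symmetric]
      by (intro tendsto_intros levy_continuity1[OF real_distribution_sum_law \<mu> weak_conv_m_subseq[OF weak q]])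
    ultimately show "(\<lambda>n. char (centred_law b (q n)) t) \<longlonglongrightarrow> char L t"
      unfolding char_centred_law[where a = a] by (simp only:)
  qed
  let ?l = "\<lambda>s. LINT x|L. exp (- s * x)"
  have intL: "integrable L (\<lambda>x. exp (- s * x))" and limL: "(\<lambda>n. ?E (q n) s) \<longlonglongrightarrow> ?l s" if "s \<ge> 0" for s
    using weak_conv_exp_moments[OF real_distribution_centred_law L conv integrable_exp_centred_law[OF _ b] ev[OF E_bound] that]
    by (simp_all only:)
  have l1: "?l s \<ge> 1" if "s \<ge> 0" for s
    by (rule LIMSEQ_le_const[OF limL[OF that]]) (intro exI allI impI exp_moment_centred_law_ge that b)
  define \<psi> where "\<psi> s = ln (?l s)" for s
  have \<psi>: "\<psi> s \<ge> 0" "?l s = exp (\<psi> s)" if "s \<ge> 0" for s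
  proof -
    show "\<psi> s \<ge> 0" unfolding \<psi>_def by (rule ln_ge_zero[OF l1[OF that]])
    have "0 < ?l s" using l1[OF that] by linarith
    then show "?l s = exp (\<psi> s)" unfolding \<psi>_def by (simp only: exp_ln)
  qed
  have power: "\<psi> s = \<psi> 1 * s powr \<alpha>" if "s > 0" for s
  proof (rule stable_exponent_is_power[where \<rho> = \<rho>])
    show "\<psi> s \<ge> 0" if "s \<ge> 0" for s using \<psi>(1)[OF that] .
    show "\<exists>d. \<forall>s\<ge>0. \<psi> (u * s) + \<psi> (v * s) = \<psi> ((u powr \<alpha> + v powr \<alpha>) powr (1 / \<alpha>) * s) + d * s"
      if uv: "u > 0" "v > 0" for u v
    proof -
      obtain d where d: "\<And>s. s \<ge> 0 \<Longrightarrow> ?l (u * s) * ?l (v * s) = ?l ((u powr \<alpha> + v powr \<alpha>) powr (1 / \<alpha>) * s) * exp (d * s)"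
        using laplace_stable[OF stable, of c0, folded L_def, OF intL uv] by blast
      have "\<psi> (u * s) + \<psi> (v * s) = \<psi> ((u powr \<alpha> + v powr \<alpha>) powr (1 / \<alpha>) * s) + d * s" if s: "s \<ge> 0" for s
      proof -
        have nonneg: "u * s \<ge> 0" "v * s \<ge> 0" "(u powr \<alpha> + v powr \<alpha>) powr (1 / \<alpha>) * s \<ge> 0"
          using uv s by simp_all
        have "exp (\<psi> (u * s) + \<psi> (v * s)) = exp (\<psi> ((u powr \<alpha> + v powr \<alpha>) powr (1 / \<alpha>) * s) + d * s)"
          unfolding exp_add nonneg[THEN \<psi>(2), symmetric] by (rule d[OF s])
        then show ?thesis by (simp only: exp_inj_iff)
      qed
      then show ?thesis by blast
    qed
    show "(\<lambda>k. \<rho> ^ k * \<psi> (u / \<rho> ^ k)) \<longlonglongrightarrow> 0" if u: "u > 0" for u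
    proof -
      obtain m where m: "u \<le> \<rho> ^ m" using real_arch_pow[OF \<rho>(1), of u] by (auto intro: less_imp_le)
      have upper: "\<psi> (u / \<rho> ^ k) \<le> C * 2 ^ m / 2 ^ k" if k: "m \<le> k" for k
      proof -
        have "?l (u / \<rho> ^ k) \<le> exp (C * 2 ^ m / 2 ^ k)"
          using u \<rho> by (intro tendsto_upperbound[OF limL ev[OF E_small[OF u m k]]]) auto
        then show ?thesis using \<psi>(2)[of "u / \<rho> ^ k"] u \<rho> by simp
      qed
      have lim: "(\<lambda>k. C * 2 ^ m * (\<rho> / 2) ^ k) \<longlonglongrightarrow> C * 2 ^ m * 0"
        using \<rho> by (intro tendsto_intros LIMSEQ_realpow_zero) auto
      show ?thesis
      proof (rule tendsto_sandwich[OF _ _ tendsto_const lim[unfolded mult_zero_right]])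
        show "\<forall>\<^sub>F k in sequentially. 0 \<le> \<rho> ^ k * \<psi> (u / \<rho> ^ k)"
          using u \<rho> by (intro always_eventually allI mult_nonneg_nonneg \<psi>(1)) auto
        show "\<forall>\<^sub>F k in sequentially. \<rho> ^ k * \<psi> (u / \<rho> ^ k) \<le> C * 2 ^ m * (\<rho> / 2) ^ k"
          using eventually_ge_at_top[of m]
        proof eventually_elim
          case (elim k)
          have "\<rho> ^ k * \<psi> (u / \<rho> ^ k) \<le> \<rho> ^ k * (C * 2 ^ m / 2 ^ k)"
            using upper[OF elim] \<rho> by (intro mult_left_mono) auto
          then show ?case by (simp add: power_divide mult_ac)
        qed
      qed
    qed
  qed (use \<rho> \<alpha> that in auto)
  have \<gamma>: "\<psi> 1 > 0"
  proof (rule ccontr)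
    assume "\<not> ?thesis"
    then have z: "\<psi> 1 = 0" using \<psi>(1)[of 1] by simp
    then have "\<psi> 2 = 0" using power[of 2] by simp
    then have "?l 1 = 1" "?l 2 = 1" using \<psi>(2)[of 1] \<psi>(2)[of 2] z by (simp_all only: exp_zero zero_le_one zero_le_numeral)
    then have "AE x in L. x = 0" by (intro L.zero_if_exp_moments_1 intL) simp_all
    then show False unfolding L_def by (rule stable_shift_not_zero[OF stable])
  qed
  have int1: "integrable L (\<lambda>x. x)"
  proof -
    have "integrable L (\<lambda>x. \<bar>x\<bar>)"
      by (rule weak_conv_integrable[OF real_distribution_centred_law L conv _ _ _ ev[OF abs_bound]])
         (simp_all only: abs_ge_zero integrable_abs[OF integrable_centred_law] isCont_rabs[OF continuous_ident])
    then show ?thesis by (rule Bochner_Integration.integrable_bound) simp_all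
  qed
  have L_power: "?l s = exp (\<psi> 1 * s powr \<alpha>)" if "s > 0" for s
    unfolding \<psi>(2)[OF less_imp_le[OF that]] by (simp only: power[OF that])
  note sign = L.positivity_of_laplace_powr[OF intL int1 L_power \<alpha> \<gamma>]
  have ge: "measure L {0..} = 1 - 1 / \<alpha>"
  proof -
    have "{0..} = {0<..} \<union> {0::real}" by auto
    moreover have "measure L ({0<..} \<union> {0}) = measure L {0<..} + measure L {0}"
      by (intro L.finite_measure_Union) auto
    ultimately show ?thesis using sign by simp
  qed
  have "{0..} - {0<..} = {0::real}" by auto
  then have "frontier {0<..} = {0::real}" "frontier {0..} = {0::real}"
    unfolding frontier_def by (simp_all add: interior_open)
  then have fr: "emeasure L (frontier {0<..}) = 0" "emeasure L (frontier {0..}) = 0"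
    using sign(1) by (simp_all add: L.emeasure_eq_measure)
  have gt_lim: "(\<lambda>n. measure (centred_law b (q n)) {0<..}) \<longlonglongrightarrow> measure L {0<..}"
    by (rule weak_conv_imp_continuity_set_conv[OF real_distribution_centred_law L conv _ fr(1)]) simp
  have ge_lim: "(\<lambda>n. measure (centred_law b (q n)) {0..}) \<longlonglongrightarrow> measure L {0..}"
    by (rule weak_conv_imp_continuity_set_conv[OF real_distribution_centred_law L conv _ fr(2)]) simp
  show ?thesis
  proof (intro exI[of _ s] conjI)
    show "(\<lambda>n. measure (centred_law b (r (s n))) {0<..}) \<longlonglongrightarrow> 1 - 1 / \<alpha>"
      using gt_lim by (simp only: sign(2) q_def)
    show "(\<lambda>n. measure (centred_law b (r (s n))) {0..}) \<longlonglongrightarrow> 1 - 1 / \<alpha>"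
      using ge_lim by (simp only: ge q_def)
  qed (rule s(1))
qed

lemma sign_limit:
  assumes b: "\<And>n. b n > 0" and stable: "stable_law \<alpha> \<mu>" and weak: "weak_conv_m (sum_law b a) \<mu>"
    and \<alpha>: "1 < \<alpha>" "\<alpha> \<le> 2" and nondeg: "\<nexists>c. M = return borel c"
  shows "(\<lambda>n. measure (centred_law b n) {0<..}) \<longlonglongrightarrow> 1 - 1 / \<alpha>"
    and "(\<lambda>n. measure (centred_law b n) {0..}) \<longlonglongrightarrow> 1 - 1 / \<alpha>"
proof -
  have \<mu>: "real_distribution \<mu>" using stable by (rule stable_real_distribution)
  define \<kappa> where "\<kappa> = (2::real) powr (1 / \<alpha>)"
  \<comment> \<open>any \<open>\<rho>\<close> strictly between \<open>2 powr (1 / \<alpha>)\<close> and 2 will do; there is one because \<open>\<alpha> > 1\<close>\<close>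
  define \<rho> where "\<rho> = (\<kappa> + 2) / 2"
  have "\<kappa> < 2 powr 1" unfolding \<kappa>_def using \<alpha> by (intro powr_less_mono) auto
  moreover have "2 powr 0 < \<kappa>" unfolding \<kappa>_def using \<alpha> by (intro powr_less_mono) auto
  ultimately have \<rho>: "1 < \<rho>" "\<rho> < 2" "0 < \<kappa>" "\<kappa> < \<rho>" by (auto simp: \<rho>_def)
  obtain C where C: "\<forall>\<^sub>F n in sequentially. real n * (LINT x|M. min ((x / b n)\<^sup>2) 1) \<le> C"
    using truncated_second_moment_bound[OF real_distribution_axioms nondeg real_distribution_sum_law \<mu> weak b norm_char_sum_law]
    by blast
  have growth: "\<forall>\<^sub>F n in sequentially. b (2 * n) \<le> \<rho> * b n"
    by (rule norming_growth[OF real_distribution_sum_law \<mu> weak stable_nondegenerate[OF stable] b norm_char_sum_law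
          norm_char_stable[OF stable, folded \<kappa>_def] \<rho>(3,4)])
  obtain C' where tm: "\<forall>\<^sub>F n in sequentially. \<forall>k. real n * truncated_moment M (1 / (\<rho> ^ k * b n)) \<le> C' / 2 ^ k"
    using truncated_moment_bound[OF integrable_id b \<rho>(1,2) C growth] by blast
  have limit: "f \<longlonglongrightarrow> l" if subseq: "\<And>r :: nat \<Rightarrow> nat. strict_mono r \<Longrightarrow> \<exists>s :: nat \<Rightarrow> nat. strict_mono s \<and> (\<lambda>n. f (r (s n))) \<longlonglongrightarrow> l"
    for f :: "nat \<Rightarrow> real" and l
  proof (rule ccontr)
    assume "\<not> f \<longlonglongrightarrow> l"
    then obtain e where e: "e > 0" "\<not> (\<forall>\<^sub>F n in sequentially. dist (f n) l < e)"
      unfolding tendsto_iff by blast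
    from not_eventually_sequentiallyD[OF e(2)]
    obtain r :: "nat \<Rightarrow> nat" where r: "strict_mono r" "\<forall>n. \<not> dist (f (r n)) l < e"
      by (elim exE conjE)
    obtain s where "(\<lambda>n. f (r (s n))) \<longlonglongrightarrow> l" using subseq[OF r(1)] by blast
    then have "\<forall>\<^sub>F n in sequentially. dist (f (r (s n))) l < e" using e(1) by (rule tendstoD)
    then show False using r(2) by (simp add: eventually_sequentially)
  qed
  note sub = subsequential_sign_limit[OF b stable weak \<rho>(1,2) \<alpha> tm]
  show "(\<lambda>n. measure (centred_law b n) {0<..}) \<longlonglongrightarrow> 1 - 1 / \<alpha>"
    by (rule limit) (use sub in blast)
  show "(\<lambda>n. measure (centred_law b n) {0..}) \<longlonglongrightarrow> 1 - 1 / \<alpha>"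
    by (rule limit) (use sub in blast)
qed

end

section \<open>The maximum-likelihood estimator\<close>

text \<open>
  The upper bound \<open>ln y \<le> y - 1\<close>, the tangent of the concave log-likelihood at 0, gives the
  second implication without a strict form of concavity; ties are left open, and they are
  asymptotically negligible.
\<close>

lemma mle_sign:
  fixes x :: "nat \<Rightarrow> 'a"
  assumes pos: "\<And>i. i < n \<Longrightarrow> f\<^sub>0 (x i) > 0" "\<And>i. i < n \<Longrightarrow> f\<^sub>1 (x i) > 0"
    and mle: "is_mle f\<^sub>0 f\<^sub>1 n x \<theta>"
  shows "(\<Sum>i<n. f\<^sub>1 (x i) / f\<^sub>0 (x i)) > real n \<Longrightarrow> \<theta> > 0"
    and "\<theta> > 0 \<Longrightarrow> (\<Sum>i<n. f\<^sub>1 (x i) / f\<^sub>0 (x i)) \<ge> real n"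
proof -
  let ?l = "log_likelihood f\<^sub>0 f\<^sub>1 n x"
  let ?score = "\<Sum>i<n. f\<^sub>1 (x i) / f\<^sub>0 (x i) - 1"
  have score: "?score = (\<Sum>i<n. f\<^sub>1 (x i) / f\<^sub>0 (x i)) - real n" by (simp add: sum_subtractf)
  have \<theta>: "0 \<le> \<theta>" "\<theta> \<le> 1" and max: "\<And>t. 0 \<le> t \<Longrightarrow> t \<le> 1 \<Longrightarrow> ?l t \<le> ?l \<theta>"
    using mle by (auto simp: is_mle_def is_arg_max_def not_less)
  show "\<theta> > 0" if "(\<Sum>i<n. f\<^sub>1 (x i) / f\<^sub>0 (x i)) > real n"
  proof (rule ccontr)
    assume "\<not> \<theta> > 0"
    then have 0: "\<theta> = 0" using \<theta> by simp
    have "(?l has_real_derivative (\<Sum>i<n. (f\<^sub>1 (x i) - f\<^sub>0 (x i)) / f\<^sub>0 (x i))) (at 0)"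
      unfolding log_likelihood_def using pos by (auto intro!: derivative_eq_intros sum.cong)
    moreover have "(\<Sum>i<n. (f\<^sub>1 (x i) - f\<^sub>0 (x i)) / f\<^sub>0 (x i)) = ?score"
      using pos by (intro sum.cong) (auto simp: diff_divide_distrib less_imp_neq[THEN not_sym])
    ultimately have "(?l has_real_derivative ?score) (at 0)" by simp
    moreover have "?score > 0" using that score by simp
    ultimately obtain d where d: "d > 0" "\<And>h. 0 < h \<Longrightarrow> h < d \<Longrightarrow> ?l 0 < ?l (0 + h)"
      using DERIV_pos_inc_right by blast
    then have "?l 0 < ?l (min (d / 2) 1)" using d(2)[of "min (d / 2) 1"] by (auto simp: min_def)
    moreover have "?l (min (d / 2) 1) \<le> ?l 0" using max[of "min (d / 2) 1"] d(1) 0 by auto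
    ultimately show False by simp
  qed
  show "(\<Sum>i<n. f\<^sub>1 (x i) / f\<^sub>0 (x i)) \<ge> real n" if "\<theta> > 0"
  proof -
    have "0 \<le> ?l \<theta> - ?l 0" using max[of 0] by simp
    also have "\<dots> = (\<Sum>i<n. ln ((1 - \<theta>) * f\<^sub>0 (x i) + \<theta> * f\<^sub>1 (x i)) - ln (f\<^sub>0 (x i)))"
      by (simp add: log_likelihood_def sum_subtractf)
    also have "\<dots> \<le> (\<Sum>i<n. \<theta> * (f\<^sub>1 (x i) / f\<^sub>0 (x i) - 1))"
    proof (rule sum_mono)
      fix i assume "i \<in> {..<n}"
      then have p: "f\<^sub>0 (x i) > 0" "f\<^sub>1 (x i) > 0" using pos by auto
      have q: "0 < (1 - \<theta>) * f\<^sub>0 (x i) + \<theta> * f\<^sub>1 (x i)"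
        using p \<theta> that by (intro add_nonneg_pos) auto
      have "ln ((1 - \<theta>) * f\<^sub>0 (x i) + \<theta> * f\<^sub>1 (x i)) - ln (f\<^sub>0 (x i))
          = ln (((1 - \<theta>) * f\<^sub>0 (x i) + \<theta> * f\<^sub>1 (x i)) / f\<^sub>0 (x i))"
        using p q by (simp add: ln_div)
      also have "\<dots> \<le> ((1 - \<theta>) * f\<^sub>0 (x i) + \<theta> * f\<^sub>1 (x i)) / f\<^sub>0 (x i) - 1"
        using p q by (intro ln_le_minus_one) simp
      also have "\<dots> = \<theta> * (f\<^sub>1 (x i) / f\<^sub>0 (x i) - 1)" using p by (simp add: field_simps)
      finally show "ln ((1 - \<theta>) * f\<^sub>0 (x i) + \<theta> * f\<^sub>1 (x i)) - ln (f\<^sub>0 (x i)) \<le> \<theta> * (f\<^sub>1 (x i) / f\<^sub>0 (x i) - 1)" .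
    qed
    also have "\<dots> = \<theta> * ?score" by (simp add: sum_distrib_left)
    finally have "0 \<le> \<theta> * ?score" .
    then show ?thesis using that score by (simp add: zero_le_mult_iff)
  qed
qed

theorem mainTheorem1:
  fixes M F\<^sub>0 F\<^sub>1 :: "'a measure" and S :: "'a set"
    and f\<^sub>0 f\<^sub>1 h :: "'a \<Rightarrow> real"
    and P :: "'w measure" and X :: "nat \<Rightarrow> 'w \<Rightarrow> 'a"
    and \<theta> :: "nat \<Rightarrow> 'w \<Rightarrow> real" and \<alpha> :: real
  assumes "sigma_finite_measure M"
    and "S \<in> sets M"
    and "f\<^sub>0 \<in> borel_measurable M" and "f\<^sub>1 \<in> borel_measurable M"
    and "\<And>x. x \<in> S \<Longrightarrow> 0 < f\<^sub>0 x" and "\<And>x. x \<in> S \<Longrightarrow> 0 < f\<^sub>1 x"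
    and "\<And>x. x \<in> space M - S \<Longrightarrow> f\<^sub>0 x = 0" and "\<And>x. x \<in> space M - S \<Longrightarrow> f\<^sub>1 x = 0"
    and "F\<^sub>0 = density M (\<lambda>x. ennreal (f\<^sub>0 x))" and "F\<^sub>1 = density M (\<lambda>x. ennreal (f\<^sub>1 x))"
    and "prob_space F\<^sub>0" and "prob_space F\<^sub>1"
    and "F\<^sub>0 \<noteq> F\<^sub>1"
    and "\<And>x. h x = f\<^sub>1 x / f\<^sub>0 x"
    and "prob_space P"
    and "prob_space.indep_vars P (\<lambda>_. M) X UNIV"
    and "\<And>i. distr P M (X i) = F\<^sub>0"
    and "\<And>n. \<theta> n \<in> borel_measurable P"
    and "\<And>n. AE \<omega> in P. is_mle f\<^sub>0 f\<^sub>1 n (\<lambda>i. X i \<omega>) (\<theta> n \<omega>)"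
    and "1 < \<alpha>" and "\<alpha> \<le> 2"
    and "domain_of_attraction \<alpha> (distr P borel (\<lambda>\<omega>. h (X 0 \<omega>)))"
  shows "(\<lambda>n. measure P {\<omega> \<in> space P. 0 < \<theta> n \<omega>}) \<longlonglongrightarrow> 1 - 1 / \<alpha>"
proof -
  note f_meas [measurable] = assms(3,4) and S_meas [measurable] = assms(2)
  note F0 = assms(9) and F1 = assms(10) and h = assms(14)
  interpret P: prob_space P by fact
  interpret F0: prob_space F\<^sub>0 by fact
  interpret F1: prob_space F\<^sub>1 by fact
  have X_meas [measurable]: "X i \<in> measurable P M" for i
    using assms(16) unfolding P.indep_vars_def2 by blast
  have h_meas [measurable]: "h \<in> borel_measurable M"
    by (subst measurable_cong[of M h "\<lambda>x. f\<^sub>1 x / f\<^sub>0 x"]) (auto simp: h)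
  have f0_nonneg: "0 \<le> f\<^sub>0 x" and f1_nonneg: "0 \<le> f\<^sub>1 x" if "x \<in> space M" for x
    using assms(5,6,7,8)[of x] that by (cases "x \<in> S"; force)+
  define \<nu> where "\<nu> = distr P borel (\<lambda>\<omega>. h (X 0 \<omega>))"
  have \<nu>_eq: "distr P borel (\<lambda>\<omega>. h (X i \<omega>)) = distr F\<^sub>0 borel h" for i
    using distr_distr[of h M borel "X i" P] assms(17)[of i] by (simp add: comp_def)
  have \<nu>: "\<nu> = distr F\<^sub>0 borel h" unfolding \<nu>_def by (rule \<nu>_eq)
  have h_F0 [measurable]: "h \<in> borel_measurable F\<^sub>0" unfolding F0 by simp
  have \<nu>_real: "real_distribution \<nu>" unfolding \<nu> by (rule F0.real_distribution_distr) simp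
  have F0_S: "AE x in F\<^sub>0. x \<in> S"
  proof -
    have "0 < ennreal (f\<^sub>0 x) \<longrightarrow> x \<in> S" if "x \<in> space M" for x
      using assms(7)[of x] that by (cases "x \<in> S") auto
    then show ?thesis unfolding F0 by (subst AE_density) auto
  qed
  have h_f: "f\<^sub>0 x * h x = f\<^sub>1 x" if "x \<in> space M" for x
    using assms(5,7,8)[of x] that by (cases "x \<in> S") (auto simp: h)
  have mean: "has_bochner_integral \<nu> (\<lambda>y. y) 1"
  proof -
    have "(\<integral>\<^sup>+x. ennreal (f\<^sub>1 x) \<partial>M) = emeasure F\<^sub>1 (space M)"
      unfolding F1 by (subst emeasure_density) (auto intro!: nn_integral_cong)
    also have "\<dots> = 1" using F1.emeasure_space_1 by (simp add: F1)
    finally have "has_bochner_integral M f\<^sub>1 1"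
      using f1_nonneg by (intro has_bochner_integral_nn_integral) auto
    then have "has_bochner_integral M (\<lambda>x. f\<^sub>0 x *\<^sub>R h x) 1"
      by (subst has_bochner_integral_cong[where N = M and g = f\<^sub>1]) (auto simp: h_f)
    then have "has_bochner_integral F\<^sub>0 h 1"
      unfolding F0 using f0_nonneg by (intro has_bochner_integral_density) auto
    then show ?thesis unfolding \<nu> by (intro has_bochner_integral_distr) auto
  qed
  interpret mean_one_distribution \<nu>
  proof (intro mean_one_distribution.intro mean_one_distribution_axioms.intro \<nu>_real)
    have "AE x in F\<^sub>0. 0 \<le> h x"
      using F0_S by eventually_elim (use assms(5,6) in \<open>auto simp: h intro: less_imp_le\<close>)
    then show "AE y in \<nu>. 0 \<le> y" unfolding \<nu> by (subst AE_distr_iff) auto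
    show "integrable \<nu> (\<lambda>y. y)" using mean by (rule integrable.intros)
    show "(LINT y|\<nu>. y) = 1" using mean by (rule has_bochner_integral_integral_eq)
  qed
  have nondeg: "\<nexists>c. \<nu> = return borel c"
  proof
    assume "\<exists>c. \<nu> = return borel c"
    then obtain c where c: "\<nu> = return borel c" ..
    then have "c = 1" using mean_one by (simp add: integral_return)
    then have "AE y in \<nu>. y = 1" unfolding c by (subst AE_return) auto
    then have "AE x in F\<^sub>0. h x = 1" unfolding \<nu> by (subst (asm) AE_distr_iff) auto
    then have "AE x in M. 0 < ennreal (f\<^sub>0 x) \<longrightarrow> h x = 1"
      unfolding F0 by (subst (asm) AE_density) auto
    then have "AE x in M. ennreal (f\<^sub>0 x) = ennreal (f\<^sub>1 x)"
    proof (rule AE_mp, intro AE_I2 impI)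
      fix x assume x: "x \<in> space M" and imp: "0 < ennreal (f\<^sub>0 x) \<longrightarrow> h x = 1"
      show "ennreal (f\<^sub>0 x) = ennreal (f\<^sub>1 x)"
        using imp h_f[OF x] assms(5,7,8)[of x] x by (cases "x \<in> S") auto
    qed
    then have "F\<^sub>0 = F\<^sub>1" unfolding F0 F1 by (intro density_cong) auto
    then show False using assms(13) by contradiction
  qed
  obtain A B \<mu> where AB: "\<And>n. 0 < B n" "stable_law \<alpha> \<mu>" "weak_conv_m (sum_law B A) \<mu>"
    using assms(22) unfolding domain_of_attraction_def sum_law_def \<nu>_def[symmetric] by auto
  have law: "distr P (PiM UNIV (\<lambda>_. borel)) (\<lambda>\<omega> i. h (X i \<omega>)) = iid \<nu>"
  proof -
    have ind: "P.indep_vars (\<lambda>_. borel) (\<lambda>i \<omega>. h (X i \<omega>)) UNIV"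
      by (rule P.indep_vars_compose2[OF assms(16)]) simp
    have "distr P (PiM UNIV (\<lambda>_. borel)) (\<lambda>\<omega>. \<lambda>i\<in>UNIV. h (X i \<omega>)) = PiM UNIV (\<lambda>i. distr P borel (\<lambda>\<omega>. h (X i \<omega>)))"
      by (rule P.indep_vars_iff_distr_eq_PiM[THEN iffD1, OF _ _ ind]) auto
    then show ?thesis by (simp add: \<nu>_eq \<nu> restrict_def)
  qed
  have transfer: "measure (centred_law B n) A = measure P {\<omega> \<in> space P. (\<Sum>i<n. h (X i \<omega>)) / B n - real n / B n \<in> A}"
    if [measurable]: "A \<in> sets borel" for n A
  proof -
    have [measurable]: "(\<lambda>\<omega> i. h (X i \<omega>)) \<in> measurable P (PiM UNIV (\<lambda>_. borel))"
      by (rule measurable_PiM_single') auto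
    have "centred_law B n = distr P borel (\<lambda>\<omega>. (\<Sum>i<n. h (X i \<omega>)) / B n - real n / B n)"
      unfolding centred_law_def sum_law_def law[symmetric] by (subst distr_distr) (auto simp: comp_def)
    then show ?thesis by (simp add: measure_distr vimage_def Int_def conj_commute)
  qed
  have sandwich: "measure (centred_law B n) {0<..} \<le> measure P {\<omega> \<in> space P. 0 < \<theta> n \<omega>}"
    "measure P {\<omega> \<in> space P. 0 < \<theta> n \<omega>} \<le> measure (centred_law B n) {0..}" for n
  proof -
    note [measurable] = assms(18)
    have "AE \<omega> in P. X i \<omega> \<in> S" for i
      using F0_S unfolding assms(17)[of i, symmetric] by (subst (asm) AE_distr_iff) auto
    then have "AE \<omega> in P. \<forall>i. X i \<omega> \<in> S" by (simp add: AE_all_countable)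
    with assms(19)[of n] have sign: "AE \<omega> in P. ((\<Sum>i<n. h (X i \<omega>)) > real n \<longrightarrow> 0 < \<theta> n \<omega>)
       \<and> (0 < \<theta> n \<omega> \<longrightarrow> (\<Sum>i<n. h (X i \<omega>)) \<ge> real n)"
    proof eventually_elim
      case (elim \<omega>)
      show ?case using mle_sign[OF _ _ elim(1)] elim(2) assms(5,6) by (simp add: h)
    qed
    have B: "(\<Sum>i<n. h (X i \<omega>)) / B n - real n / B n = ((\<Sum>i<n. h (X i \<omega>)) - real n) / B n" for \<omega>
      by (simp add: diff_divide_distrib)
    show "measure (centred_law B n) {0<..} \<le> measure P {\<omega> \<in> space P. 0 < \<theta> n \<omega>}"
      unfolding transfer[OF greaterThan_borel]
      by (rule P.finite_measure_mono_AE)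
         (use sign AB(1)[of n] in \<open>auto simp: B zero_less_divide_iff elim!: eventually_mono\<close>)
    have "measure (centred_law B n) {0..} = measure P {\<omega> \<in> space P. (\<Sum>i<n. h (X i \<omega>)) / B n - real n / B n \<in> {0..}}"
      by (rule transfer) simp
    also have "\<dots> \<ge> measure P {\<omega> \<in> space P. 0 < \<theta> n \<omega>}"
      by (rule P.finite_measure_mono_AE)
         (use sign AB(1)[of n] in \<open>auto simp: B zero_le_divide_iff elim!: eventually_mono\<close>)
    finally show "measure P {\<omega> \<in> space P. 0 < \<theta> n \<omega>} \<le> measure (centred_law B n) {0..}" .
  qed
  show ?thesis
    by (rule tendsto_sandwich[OF _ _ sign_limit[OF AB(1,2,3) assms(20,21) nondeg]])
       (use sandwich in auto)
qed

end
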